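(* Let $r,n\ge 1$ be integers, let $\xi=e^{2\pi i/r}$, and let $\Gamma=\mathbb{Z}_r$, realized multiplicatively as the group $\{1,\xi,\dots,\xi^{r-1}\}$ of $r$-th roots of unity. Let $\Delta\Gamma^n=\{(g,\dots,g):g\in\Gamma\}$, $\widetilde{\Gamma}^n=\Gamma^n/\Delta\Gamma^n$, and let $e_0$ be the identity of $S_n$. Identify $\widetilde{\Gamma}^n\rtimes S_n$ with the quotient $(\Gamma^n\rtimes S_n)/(\Delta\Gamma^n\rtimes\{e_0\})$ via $(g,\sigma)\mapsto(\widetilde g,\sigma)$. For a sequence $\mathbf{k}=(k_0,\dots,k_{r-1})$ of non-negative integers with $\sum_i k_i=n$, let $\mathbb{C}M(\mathbf{k})$ be the $\Gamma^n\rtimes S_n$-module defined below. Then: (1) $\mathbb{C}M(\mathbf{k})$ is (i.e. descends to) a representation of $\widetilde{\Gamma}^n\rtimes S_n$, that is, $\Delta\Gamma^n\rtimes\{e_0\}$ acts trivially on it, if and only if $r$ divides $\sum_{i} i\,k_i$; in that case it is an irreducible representation of $\widetilde{\Gamma}^n\rtimes S_n$ of degree $\binom{n}{k_0,\dots,k_{r-1}}=\frac{n!}{k_0!\cdots k_{r-1}!}$. (2) The pair $(\widetilde{\Gamma}^n\rtimes S_n, S_n)$ is a Gelfand pair, and the representation $\mathrm{Ind}_{S_n}^{\widetilde{\Gamma}^n\rtimes S_n}\mathbf{1}$ induced from the trivial representation of $S_n$ decomposes into irreducibles as $$\mathrm{Ind}_{S_n}^{\widetilde{\Gamma}^n\rtimes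 S_n}\mathbf{1}=\bigoplus_{\substack{\mathbf{k}=(k_0,\dots,k_{r-1})\in\mathbb{Z}_{\ge0}^r\\ \sum_i k_i=n,\ r\mid \sum_i i k_i}}\mathbb{C}M(\mathbf{k}).$$
   Context: $S_n$ acts on $\Gamma^n$ by $\sigma(h)=(h_{\sigma^{-1}(1)},\dots,h_{\sigma^{-1}(n)})$, and the semidirect products have multiplication $(g,\sigma)(h,\tau)=(g\,\sigma(h),\sigma\tau)$; $S_n$ is regarded as the subgroup $\{(1,\sigma)\}$. A pair $(G,K)$ of a finite group and a subgroup is a Gelfand pair if the permutation representation of $G$ on functions on $G/K$ (equivalently $\mathrm{Ind}_K^G\mathbf 1$) is multiplicity free. Definition of $\mathbb{C}M(\mathbf{k})$: for $\mathbf k=(k_0,\dots,k_{r-1})$ with $\sum k_i=n$, let $\lambda=(\lambda_1,\dots,\lambda_n)$ be the sequence $(0^{k_0},1^{k_1},\dots,(r-1)^{k_{r-1}})$ (the value $i$ occurs $k_i$ times). With $x_1,\dots,x_n$ algebraically independent variables, let $M(\mathbf k)=\{x_{\sigma(1)}^{\lambda_1}\cdots x_{\sigma(n)}^{\lambda_n}:\sigma\in S_n\}$ and let $\mathbb{C}M(\mathbf k)$ be the complex vector space with basis $M(\mathbf k)$, on which $\Gamma^n\rtimes S_n$ acts by $(g,\sigma)\cdot f(x_1,\dots,x_n)=f(g_1^{-1}x_{\sigma(1)},\dots,g_n^{-1}x_{\sigma(n)})$ for $g=(g_1,\dots,g_n)\in\Gamma^n$.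
   Formalization: The printed action f(g_1^{-1}x_{σ(1)},…,g_n^{-1}x_{σ(n)}) is not multiplicative for (g,σ)(h,τ)=(gσ(h),στ); it is corrected to f(g_{σ(1)}^{-1}x_{σ(1)},…,g_{σ(n)}^{-1}x_{σ(n)}), which agrees with it on Γ^n and on S_n. *)

theory Defs
  imports
    "HOL-Algebra.Sym_Groups"
    "HOL-Algebra.Product_Groups"
    "HOL-Algebra.Left_Coset"
    "HOL-Library.Poly_Mapping"
    "HOL-Library.Function_Algebras"
    Complex_Main
begin

section \<open>Complex representations of groups\<close>

record ('g, 'v) crep =
  rscale :: "complex \<Rightarrow> 'v \<Rightarrow> 'v"
  rspace :: "'v set"
  ract :: "'g \<Rightarrow> 'v \<Rightarrow> 'v"

definition linear_map_on ::
    "(complex \<Rightarrow> 'v \<Rightarrow> 'v) \<Rightarrow> (complex \<Rightarrow> 'w \<Rightarrow> 'w) \<Rightarrow> 'v set \<Rightarrow> ('v::ab_group_add \<Rightarrow> 'w::ab_group_add) \<Rightarrow> bool" where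
  "linear_map_on s1 s2 V T \<longleftrightarrow>
     (\<forall>u\<in>V. \<forall>v\<in>V. T (u + v) = T u + T v) \<and> (\<forall>c. \<forall>v\<in>V. T (s1 c v) = s2 c (T v))"

definition is_rep :: "('g, 'm) monoid_scheme \<Rightarrow> ('g, 'v::ab_group_add) crep \<Rightarrow> bool" where
  "is_rep G R \<longleftrightarrow>
     Group.group G \<and>
     vector_space (rscale R) \<and>
     Modules.module.subspace (rscale R) (rspace R) \<and>
     (\<forall>g\<in>carrier G. ract R g ` rspace R \<subseteq> rspace R \<and>
        linear_map_on (rscale R) (rscale R) (rspace R) (ract R g)) \<and>
     (\<forall>v\<in>rspace R. ract R \<one>\<^bsub>G\<^esub> v = v) \<and>
     (\<forall>g\<in>carrier G. \<forall>h\<in>carrier G. \<forall>v\<in>rspace R.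
        ract R (g \<otimes>\<^bsub>G\<^esub> h) v = ract R g (ract R h v))"

definition rep_degree :: "('g, 'v::ab_group_add) crep \<Rightarrow> nat" where
  "rep_degree R = vector_space.dim (rscale R) (rspace R)"

definition irreducible_rep :: "('g, 'm) monoid_scheme \<Rightarrow> ('g, 'v::ab_group_add) crep \<Rightarrow> bool" where
  "irreducible_rep G R \<longleftrightarrow>
     is_rep G R \<and> rspace R \<noteq> {0} \<and>
     (\<forall>W. W \<subseteq> rspace R \<and> Modules.module.subspace (rscale R) W \<and>
          (\<forall>g\<in>carrier G. ract R g ` W \<subseteq> W) \<longrightarrow> W = {0} \<or> W = rspace R)"

definition rep_iso :: "('g, 'm) monoid_scheme \<Rightarrow>
    ('g, 'v::ab_group_add) crep \<Rightarrow> ('g, 'w::ab_group_add) crep \<Rightarrow> bool" where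
  "rep_iso G R S \<longleftrightarrow>
     is_rep G R \<and> is_rep G S \<and>
     (\<exists>T. bij_betw T (rspace R) (rspace S) \<and>
          linear_map_on (rscale R) (rscale S) (rspace R) T \<and>
          (\<forall>g\<in>carrier G. \<forall>v\<in>rspace R. T (ract R g v) = ract S g (T v)))"

definition rep_direct_sum :: "'i set \<Rightarrow> ('i \<Rightarrow> ('g, 'v::ab_group_add) crep) \<Rightarrow> ('g, 'i \<Rightarrow> 'v) crep" where
  "rep_direct_sum I R =
     \<lparr>rscale = (\<lambda>c f i. rscale (R i) c (f i)),
      rspace = {f. (\<forall>i\<in>I. f i \<in> rspace (R i)) \<and> (\<forall>i. i \<notin> I \<longrightarrow> f i = 0) \<and> finite {i. f i \<noteq> 0}},
      ract = (\<lambda>g f i. if i \<in> I then ract (R i) g (f i) else 0)\<rparr>"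

definition decomposes_into_irreducibles :: "('g, 'm) monoid_scheme \<Rightarrow>
    ('g, 'v::ab_group_add) crep \<Rightarrow> 'i set \<Rightarrow> ('i \<Rightarrow> ('g, 'w::ab_group_add) crep) \<Rightarrow> bool" where
  "decomposes_into_irreducibles G R I S \<longleftrightarrow>
     finite I \<and> (\<forall>i\<in>I. irreducible_rep G (S i)) \<and> rep_iso G R (rep_direct_sum I S)"

text \<open>The internal direct sum of pairwise non-isomorphic irreducible subrepresentations.\<close>

definition multiplicity_free :: "('g, 'm) monoid_scheme \<Rightarrow> ('g, 'v::ab_group_add) crep \<Rightarrow> bool" where
  "multiplicity_free G R \<longleftrightarrow>
     is_rep G R \<and>
     (\<exists>\<W>. finite \<W> \<and>
          (\<forall>W\<in>\<W>. W \<subseteq> rspace R \<and> irreducible_rep G (R\<lparr>rspace := W\<rparr>)) \<and>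
          (\<forall>W\<in>\<W>. \<forall>W'\<in>\<W>. W \<noteq> W' \<longrightarrow> \<not> rep_iso G (R\<lparr>rspace := W\<rparr>) (R\<lparr>rspace := W'\<rparr>)) \<and>
          (\<forall>v\<in>rspace R. \<exists>!w. w \<in> (\<Pi>\<^sub>E W\<in>\<W>. W) \<and> v = (\<Sum>W\<in>\<W>. w W)))"

definition acts_trivially :: "'g set \<Rightarrow> ('g, 'v) crep \<Rightarrow> bool" where
  "acts_trivially N R \<longleftrightarrow> (\<forall>x\<in>N. \<forall>v\<in>rspace R. ract R x v = v)"

text \<open>A representation \<open>R\<close> of \<open>G\<close> descends along a surjective homomorphism \<open>\<pi>\<close> from \<open>G\<close> to \<open>H\<close> if
  the same space carries a representation of \<open>H\<close> whose pullback along \<open>\<pi>\<close> is \<open>R\<close>; that action of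
  \<open>H\<close> is then obtained by evaluating \<open>R\<close> at an arbitrary preimage under \<open>\<pi>\<close>.\<close>

definition descends_to :: "('g, 'm) monoid_scheme \<Rightarrow> ('h, 'l) monoid_scheme \<Rightarrow> ('g \<Rightarrow> 'h) \<Rightarrow>
    ('g, 'v::ab_group_add) crep \<Rightarrow> bool" where
  "descends_to G H \<pi> R \<longleftrightarrow>
     (\<exists>\<rho>. is_rep H \<lparr>rscale = rscale R, rspace = rspace R, ract = \<rho>\<rparr> \<and>
          (\<forall>x\<in>carrier G. \<forall>v\<in>rspace R. \<rho> (\<pi> x) v = ract R x v))"

definition descend :: "('g, 'm) monoid_scheme \<Rightarrow> ('g \<Rightarrow> 'h) \<Rightarrow> ('g, 'v) crep \<Rightarrow> ('h, 'v) crep" where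
  "descend G \<pi> R =
     \<lparr>rscale = rscale R, rspace = rspace R, ract = (\<lambda>y. ract R (inv_into (carrier G) \<pi> y))\<rparr>"

definition trivial_rep :: "('g, complex) crep" where
  "trivial_rep = \<lparr>rscale = (*), rspace = UNIV, ract = (\<lambda>_ v. v)\<rparr>"

text \<open>Functions on \<open>G\<close> are represented by functions on the whole type that vanish off the carrier,
  and likewise for functions on \<open>G/K\<close>.\<close>

definition induced_rep :: "('g, 'm) monoid_scheme \<Rightarrow> 'g set \<Rightarrow>
    ('g, 'v::ab_group_add) crep \<Rightarrow> ('g, 'g \<Rightarrow> 'v) crep" where
  "induced_rep G K R =
     \<lparr>rscale = (\<lambda>c f x. rscale R c (f x)),
      rspace = {f. (\<forall>x\<in>carrier G. f x \<in> rspace R) \<and> (\<forall>x. x \<notin> carrier G \<longrightarrow> f x = 0) \<and>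
                   (\<forall>x\<in>carrier G. \<forall>k\<in>K. f (x \<otimes>\<^bsub>G\<^esub> k) = ract R (inv\<^bsub>G\<^esub> k) (f x))},
      ract = (\<lambda>g f x. if x \<in> carrier G then f (inv\<^bsub>G\<^esub> g \<otimes>\<^bsub>G\<^esub> x) else 0)\<rparr>"

definition permutation_rep :: "('g, 'm) monoid_scheme \<Rightarrow> 'g set \<Rightarrow> ('g, 'g set \<Rightarrow> complex) crep" where
  "permutation_rep G K =
     \<lparr>rscale = (\<lambda>c f C. c * f C),
      rspace = {f. \<forall>C. C \<notin> lcosets\<^bsub>G\<^esub> K \<longrightarrow> f C = 0},
      ract = (\<lambda>g f C. if C \<in> lcosets\<^bsub>G\<^esub> K then f (inv\<^bsub>G\<^esub> g <#\<^bsub>G\<^esub> C) else 0)\<rparr>"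

definition gelfand_pair :: "('g, 'm) monoid_scheme \<Rightarrow> 'g set \<Rightarrow> bool" where
  "gelfand_pair G K \<longleftrightarrow>
     Group.group G \<and> finite (carrier G) \<and> subgroup K G \<and> multiplicity_free G (permutation_rep G K)"


section \<open>The groups\<close>

definition semidirect :: "('a, 'm) monoid_scheme \<Rightarrow> ('b, 'l) monoid_scheme \<Rightarrow> ('b \<Rightarrow> 'a \<Rightarrow> 'a) \<Rightarrow>
    ('a \<times> 'b) monoid" where
  "semidirect N H \<phi> =
     \<lparr>carrier = carrier N \<times> carrier H,
      mult = (\<lambda>(g, \<sigma>) (h, \<tau>). (g \<otimes>\<^bsub>N\<^esub> \<phi> \<sigma> h, \<sigma> \<otimes>\<^bsub>H\<^esub> \<tau>)),
      one = (\<one>\<^bsub>N\<^esub>, \<one>\<^bsub>H\<^esub>)\<rparr>"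

lemma group_semidirect:
  assumes N: "Group.group N" and H: "Group.group H"
    and hom: "\<And>\<sigma>. \<sigma> \<in> carrier H \<Longrightarrow> \<phi> \<sigma> \<in> hom N N"
    and one: "\<And>h. h \<in> carrier N \<Longrightarrow> \<phi> \<one>\<^bsub>H\<^esub> h = h"
    and comp: "\<And>\<sigma> \<tau> h. \<lbrakk>\<sigma> \<in> carrier H; \<tau> \<in> carrier H; h \<in> carrier N\<rbrakk> \<Longrightarrow> \<phi> (\<sigma> \<otimes>\<^bsub>H\<^esub> \<tau>) h = \<phi> \<sigma> (\<phi> \<tau> h)"
  shows "Group.group (semidirect N H \<phi>)"
proof -
  interpret N: Group.group N by fact
  interpret H: Group.group H by fact
  have cl: "\<phi> \<sigma> h \<in> carrier N" if "\<sigma> \<in> carrier H" "h \<in> carrier N" for \<sigma> h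
    using hom[OF that(1)] that(2) by (auto simp: hom_def)
  have ml: "\<phi> \<sigma> (g \<otimes>\<^bsub>N\<^esub> h) = \<phi> \<sigma> g \<otimes>\<^bsub>N\<^esub> \<phi> \<sigma> h"
    if "\<sigma> \<in> carrier H" "h \<in> carrier N" "g \<in> carrier N" for \<sigma> g h
    using hom[OF that(1)] that(2,3) by (auto simp: hom_def)
  have o: "\<phi> \<sigma> \<one>\<^bsub>N\<^esub> = \<one>\<^bsub>N\<^esub>" if "\<sigma> \<in> carrier H" for \<sigma>
    using hom_one[OF hom[OF that] N N] .
  show ?thesis
  proof (rule groupI)
    fix x assume "x \<in> carrier (semidirect N H \<phi>)"
    then obtain g \<sigma> where x: "x = (g, \<sigma>)" "g \<in> carrier N" "\<sigma> \<in> carrier H"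
      by (auto simp: semidirect_def)
    let ?s = "inv\<^bsub>H\<^esub> \<sigma>"
    have "\<phi> ?s (inv\<^bsub>N\<^esub> g) \<otimes>\<^bsub>N\<^esub> \<phi> ?s g = \<one>\<^bsub>N\<^esub>"
      using x ml[of ?s g "inv\<^bsub>N\<^esub> g"] o[of ?s] by simp
    then show "\<exists>y\<in>carrier (semidirect N H \<phi>). y \<otimes>\<^bsub>semidirect N H \<phi>\<^esub> x = \<one>\<^bsub>semidirect N H \<phi>\<^esub>"
      using x cl by (intro bexI[of _ "(\<phi> ?s (inv\<^bsub>N\<^esub> g), ?s)"]) (auto simp: semidirect_def)
  qed (auto simp: semidirect_def cl ml one comp N.m_assoc H.m_assoc)
qed

definition xi :: "nat \<Rightarrow> complex" where
  "xi r = exp (2 * complex_of_real pi * \<i> / of_nat r)"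

definition Gam :: "nat \<Rightarrow> complex monoid" where
  "Gam r = \<lparr>carrier = {xi r ^ j | j. j < r}, mult = (*), one = 1\<rparr>"

definition Gam_pow :: "nat \<Rightarrow> nat \<Rightarrow> (nat \<Rightarrow> complex) monoid" where
  "Gam_pow r n = product_group {1..n} (\<lambda>_. Gam r)"

definition Gam_diag :: "nat \<Rightarrow> nat \<Rightarrow> (nat \<Rightarrow> complex) set" where
  "Gam_diag r n = {\<lambda>i\<in>{1..n}. g | g. g \<in> carrier (Gam r)}"

definition perm_act :: "nat \<Rightarrow> (nat \<Rightarrow> nat) \<Rightarrow> (nat \<Rightarrow> complex) \<Rightarrow> (nat \<Rightarrow> complex)" where
  "perm_act n \<sigma> h = (\<lambda>i\<in>{1..n}. h (inv' \<sigma> i))"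

definition wreath :: "nat \<Rightarrow> nat \<Rightarrow> ((nat \<Rightarrow> complex) \<times> (nat \<Rightarrow> nat)) monoid" where
  "wreath r n = semidirect (Gam_pow r n) (sym_group n) (perm_act n)"

definition Gam_quot :: "nat \<Rightarrow> nat \<Rightarrow> (nat \<Rightarrow> complex) set monoid" where
  "Gam_quot r n = Gam_pow r n Mod Gam_diag r n"

text \<open>\<open>S\<^sub>n\<close> acts on the cosets of the (invariant) diagonal by taking images.\<close>

definition reduced_wreath :: "nat \<Rightarrow> nat \<Rightarrow> ((nat \<Rightarrow> complex) set \<times> (nat \<Rightarrow> nat)) monoid" where
  "reduced_wreath r n = semidirect (Gam_quot r n) (sym_group n) (\<lambda>\<sigma> C. perm_act n \<sigma> ` C)"

definition diag_subgroup :: "nat \<Rightarrow> nat \<Rightarrow> ((nat \<Rightarrow> complex) \<times> (nat \<Rightarrow> nat)) set" where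
  "diag_subgroup r n = Gam_diag r n \<times> {id}"

definition wreath_proj :: "nat \<Rightarrow> nat \<Rightarrow> (nat \<Rightarrow> complex) \<times> (nat \<Rightarrow> nat) \<Rightarrow>
    (nat \<Rightarrow> complex) set \<times> (nat \<Rightarrow> nat)" where
  "wreath_proj r n = (\<lambda>(g, \<sigma>). (Gam_diag r n #>\<^bsub>Gam_pow r n\<^esub> g, \<sigma>))"

definition sym_subgroup :: "nat \<Rightarrow> nat \<Rightarrow> ((nat \<Rightarrow> complex) set \<times> (nat \<Rightarrow> nat)) set" where
  "sym_subgroup r n = {\<one>\<^bsub>Gam_quot r n\<^esub>} \<times> carrier (sym_group n)"

lemma xi_pow_r: "r \<ge> 1 \<Longrightarrow> xi r ^ r = 1"
  by (simp add: xi_def exp_of_nat_mult[symmetric])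

lemma group_Gam: "r \<ge> 1 \<Longrightarrow> Group.group (Gam r)"
proof (rule groupI)
  assume r: "r \<ge> 1"
  have red: "xi r ^ j = xi r ^ (j mod r)" for j
  proof -
    have "xi r ^ j = xi r ^ (r * (j div r) + j mod r)" by simp
    also have "\<dots> = xi r ^ (j mod r)"
      by (simp only: power_add power_mult xi_pow_r[OF r]) simp
    finally show ?thesis .
  qed
  have mem: "xi r ^ j \<in> carrier (Gam r)" for j
    unfolding Gam_def using red[of j] r by (auto intro!: exI[of _ "j mod r"])
  show "x \<otimes>\<^bsub>Gam r\<^esub> y \<in> carrier (Gam r)" if "x \<in> carrier (Gam r)" "y \<in> carrier (Gam r)" for x y
  proof -
    from that obtain i j where "x = xi r ^ i" "y = xi r ^ j" by (auto simp: Gam_def)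
    then have "x \<otimes>\<^bsub>Gam r\<^esub> y = xi r ^ (i + j)" by (simp add: Gam_def power_add)
    then show ?thesis using mem by simp
  qed
  show "\<one>\<^bsub>Gam r\<^esub> \<in> carrier (Gam r)" using mem[of 0] by (simp add: Gam_def)
  show "\<exists>y\<in>carrier (Gam r). y \<otimes>\<^bsub>Gam r\<^esub> x = \<one>\<^bsub>Gam r\<^esub>" if "x \<in> carrier (Gam r)" for x
  proof -
    from that obtain i where i: "x = xi r ^ i" "i < r" by (auto simp: Gam_def)
    then have "xi r ^ (r - i) * x = 1" by (simp add: power_add[symmetric] xi_pow_r[OF r])
    then show ?thesis using mem[of "r - i"] by (auto simp: Gam_def)
  qed
qed (auto simp: Gam_def)

lemma comm_group_Gam_pow: "r \<ge> 1 \<Longrightarrow> comm_group (Gam_pow r n)"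
proof (rule group.group_comm_groupI)
  assume "r \<ge> 1"
  then show "Group.group (Gam_pow r n)"
    unfolding Gam_pow_def by (simp add: group_Gam)
next
  fix x y
  show "x \<otimes>\<^bsub>Gam_pow r n\<^esub> y = y \<otimes>\<^bsub>Gam_pow r n\<^esub> x"
    by (simp add: Gam_pow_def product_group_def Gam_def mult.commute)
qed

lemma subgroup_Gam_diag:
  assumes "r \<ge> 1" shows "subgroup (Gam_diag r n) (Gam_pow r n)"
proof -
  interpret D: Group.group "Gam r" by (rule group_Gam) fact
  interpret P: comm_group "Gam_pow r n" by (rule comm_group_Gam_pow) fact
  show ?thesis
  proof (rule P.subgroupI)
    show "Gam_diag r n \<subseteq> carrier (Gam_pow r n)"
      by (auto simp: Gam_diag_def Gam_pow_def product_group_def)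
    show "Gam_diag r n \<noteq> {}" using D.one_closed by (auto simp: Gam_diag_def)
    fix a assume "a \<in> Gam_diag r n"
    then obtain g where g: "g \<in> carrier (Gam r)" "a = (\<lambda>i\<in>{1..n}. g)" by (auto simp: Gam_diag_def)
    then have "inv\<^bsub>Gam_pow r n\<^esub> a = (\<lambda>i\<in>{1..n}. inv\<^bsub>Gam r\<^esub> g)"
      by (intro P.inv_equality)
        (auto simp: Gam_pow_def product_group_def fun_eq_iff intro!: D.l_inv)
    then show "inv\<^bsub>Gam_pow r n\<^esub> a \<in> Gam_diag r n" using g by (auto simp: Gam_diag_def)
    fix b assume "b \<in> Gam_diag r n"
    then obtain h where h: "h \<in> carrier (Gam r)" "b = (\<lambda>i\<in>{1..n}. h)" by (auto simp: Gam_diag_def)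
    have "a \<otimes>\<^bsub>Gam_pow r n\<^esub> b = (\<lambda>i\<in>{1..n}. g \<otimes>\<^bsub>Gam r\<^esub> h)"
      using g h by (auto simp: Gam_pow_def product_group_def fun_eq_iff)
    then show "a \<otimes>\<^bsub>Gam_pow r n\<^esub> b \<in> Gam_diag r n"
      using g h D.m_closed by (auto simp: Gam_diag_def)
  qed
qed

lemma normal_Gam_diag: "r \<ge> 1 \<Longrightarrow> Gam_diag r n \<lhd> Gam_pow r n"
  by (simp only: comm_group.normal_iff_subgroup[OF comm_group_Gam_pow] subgroup_Gam_diag)

lemma inv_permutes_mem: "\<sigma> permutes {1..n} \<Longrightarrow> i \<in> {1..n} \<Longrightarrow> inv' \<sigma> i \<in> {1..n}"
  by (simp only: permutes_in_image[OF permutes_inv])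

lemma perm_act_hom:
  assumes "\<sigma> permutes {1..n}"
  shows "perm_act n \<sigma> \<in> hom (Gam_pow r n) (Gam_pow r n)"
proof (rule homI)
  fix h assume "h \<in> carrier (Gam_pow r n)"
  then have h: "h i \<in> carrier (Gam r)" if "i \<in> {1..n}" for i
    using that unfolding Gam_pow_def product_group_def by auto
  have "perm_act n \<sigma> h \<in> (\<Pi>\<^sub>E i\<in>{1..n}. carrier (Gam r))"
    unfolding perm_act_def using h[OF inv_permutes_mem[OF assms]] by (intro restrict_PiE_iff[THEN iffD2] ballI)
  then show "perm_act n \<sigma> h \<in> carrier (Gam_pow r n)"
    unfolding Gam_pow_def product_group_def by simp
next
  fix g h
  show "perm_act n \<sigma> (g \<otimes>\<^bsub>Gam_pow r n\<^esub> h) = perm_act n \<sigma> g \<otimes>\<^bsub>Gam_pow r n\<^esub> perm_act n \<sigma> h"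
    unfolding perm_act_def Gam_pow_def product_group_def monoid.simps
    by (rule restrict_ext) (simp only: restrict_apply' inv_permutes_mem[OF assms])
qed

lemma perm_act_comp:
  assumes "\<sigma> permutes {1..n}" "\<tau> permutes {1..n}"
  shows "perm_act n (\<sigma> \<circ> \<tau>) h = perm_act n \<sigma> (perm_act n \<tau> h)"
  unfolding perm_act_def
  by (rule restrict_ext)
    (simp only: restrict_apply' inv_permutes_mem[OF assms(1)] o_inv_distrib permutes_bij[OF assms(1)]
      permutes_bij[OF assms(2)] o_apply)

lemma perm_act_id: "h \<in> carrier (Gam_pow r n) \<Longrightarrow> perm_act n id h = h"
  by (simp add: perm_act_def Gam_pow_def product_group_def PiE_iff extensional_restrict)

lemma group_wreath: "r \<ge> 1 \<Longrightarrow> Group.group (wreath r n)"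
  unfolding wreath_def
  by (rule group_semidirect[OF comm_group.axioms(2)[OF comm_group_Gam_pow] sym_group_is_group])
    (simp_all only: sym_group_def partial_object.simps monoid.simps mem_Collect_eq
      perm_act_hom perm_act_id perm_act_comp)

lemma perm_act_diag:
  assumes "\<sigma> permutes {1..n}" "d \<in> Gam_diag r n"
  shows "perm_act n \<sigma> d = d"
proof -
  from assms(2) obtain g where d: "d = (\<lambda>i\<in>{1..n}. g)" by (auto simp: Gam_diag_def)
  show ?thesis
    unfolding d perm_act_def by (rule restrict_ext) (simp only: restrict_apply' inv_permutes_mem[OF assms(1)])
qed

lemma perm_act_coset:
  assumes r: "r \<ge> 1" and s: "\<sigma> permutes {1..n}" and g: "g \<in> carrier (Gam_pow r n)"
  shows "perm_act n \<sigma> ` (Gam_diag r n #>\<^bsub>Gam_pow r n\<^esub> g) = Gam_diag r n #>\<^bsub>Gam_pow r n\<^esub> perm_act n \<sigma> g"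
proof -
  have "perm_act n \<sigma> (d \<otimes>\<^bsub>Gam_pow r n\<^esub> g) = d \<otimes>\<^bsub>Gam_pow r n\<^esub> perm_act n \<sigma> g"
    if "d \<in> Gam_diag r n" for d
    using hom_mult[OF perm_act_hom[OF s] _ g, of d] that subgroup.mem_carrier[OF subgroup_Gam_diag[OF r] that]
      perm_act_diag[OF s that] by simp
  then show ?thesis unfolding r_coset_def by (simp add: image_UN)
qed

lemma group_reduced_wreath:
  assumes r: "r \<ge> 1" shows "Group.group (reduced_wreath r n)"
proof -
  interpret D: normal "Gam_diag r n" "Gam_pow r n" by (rule normal_Gam_diag) fact
  have car: "\<exists>g\<in>carrier (Gam_pow r n). C = Gam_diag r n #>\<^bsub>Gam_pow r n\<^esub> g" if "C \<in> carrier (Gam_quot r n)" for C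
    using that by (auto simp: Gam_quot_def carrier_FactGroup)
  have cl: "perm_act n \<sigma> g \<in> carrier (Gam_pow r n)"
    if "\<sigma> permutes {1..n}" "g \<in> carrier (Gam_pow r n)" for \<sigma> g
    using hom_in_carrier[OF perm_act_hom[OF that(1)] that(2)] .
  show ?thesis
    unfolding reduced_wreath_def
  proof (rule group_semidirect)
    show "Group.group (Gam_quot r n)" by (simp add: Gam_quot_def D.factorgroup_is_group)
    show "Group.group (sym_group n)" by (rule sym_group_is_group)
  next
    fix \<sigma> assume "\<sigma> \<in> carrier (sym_group n)"
    then have s: "\<sigma> permutes {1..n}" by (simp add: sym_group_def)
    show "(`) (perm_act n \<sigma>) \<in> hom (Gam_quot r n) (Gam_quot r n)"
    proof (rule homI)
      fix C assume "C \<in> carrier (Gam_quot r n)"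
      then show "perm_act n \<sigma> ` C \<in> carrier (Gam_quot r n)"
        using car[of C] perm_act_coset[OF r s] cl[OF s] by (auto simp: Gam_quot_def carrier_FactGroup)
    next
      fix C E assume "C \<in> carrier (Gam_quot r n)" "E \<in> carrier (Gam_quot r n)"
      then obtain g h where "g \<in> carrier (Gam_pow r n)" "C = Gam_diag r n #>\<^bsub>Gam_pow r n\<^esub> g"
        "h \<in> carrier (Gam_pow r n)" "E = Gam_diag r n #>\<^bsub>Gam_pow r n\<^esub> h"
        using car by meson
      then show "perm_act n \<sigma> ` (C \<otimes>\<^bsub>Gam_quot r n\<^esub> E) = perm_act n \<sigma> ` C \<otimes>\<^bsub>Gam_quot r n\<^esub> perm_act n \<sigma> ` E"
        using cl[OF s] hom_mult[OF perm_act_hom[OF s], of g r h]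
        by (simp add: Gam_quot_def D.rcos_sum perm_act_coset[OF r s])
    qed
  next
    fix C assume "C \<in> carrier (Gam_quot r n)"
    then obtain g where g: "g \<in> carrier (Gam_pow r n)" "C = Gam_diag r n #>\<^bsub>Gam_pow r n\<^esub> g"
      using car by meson
    then show "perm_act n \<one>\<^bsub>sym_group n\<^esub> ` C = C"
      using perm_act_coset[OF r permutes_id, of g] by (simp add: sym_group_def perm_act_id)
  next
    fix \<sigma> \<tau> C assume "\<sigma> \<in> carrier (sym_group n)" "\<tau> \<in> carrier (sym_group n)" "C \<in> carrier (Gam_quot r n)"
    then show "perm_act n (\<sigma> \<otimes>\<^bsub>sym_group n\<^esub> \<tau>) ` C = perm_act n \<sigma> ` perm_act n \<tau> ` C"
      by (simp add: sym_group_def perm_act_comp image_image)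
  qed
qed

lemma wreath_proj_hom:
  assumes r: "r \<ge> 1" shows "group_hom (wreath r n) (reduced_wreath r n) (wreath_proj r n)"
proof -
  interpret D: normal "Gam_diag r n" "Gam_pow r n" by (rule normal_Gam_diag) fact
  have "wreath_proj r n \<in> hom (wreath r n) (reduced_wreath r n)"
  proof (rule homI)
    fix x assume "x \<in> carrier (wreath r n)"
    then show "wreath_proj r n x \<in> carrier (reduced_wreath r n)"
      by (auto simp: wreath_def reduced_wreath_def semidirect_def wreath_proj_def Gam_quot_def carrier_FactGroup)
  next
    fix x y assume "x \<in> carrier (wreath r n)" "y \<in> carrier (wreath r n)"
    then obtain g \<sigma> h \<tau> where *: "x = (g, \<sigma>)" "y = (h, \<tau>)" "g \<in> carrier (Gam_pow r n)"
      "h \<in> carrier (Gam_pow r n)" "\<sigma> permutes {1..n}" "\<tau> permutes {1..n}"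
      by (auto simp: wreath_def semidirect_def sym_group_def)
    then show "wreath_proj r n (x \<otimes>\<^bsub>wreath r n\<^esub> y) = wreath_proj r n x \<otimes>\<^bsub>reduced_wreath r n\<^esub> wreath_proj r n y"
      using hom_in_carrier[OF perm_act_hom[OF *(5)] *(4)]
      by (simp add: wreath_def reduced_wreath_def semidirect_def wreath_proj_def Gam_quot_def
          perm_act_coset[OF r] D.rcos_sum)
  qed
  then show ?thesis
    using group_wreath[OF r] group_reduced_wreath[OF r] by (simp add: group_hom_def group_hom_axioms_def)
qed

text \<open>The identification of \<open>(\<Gamma>\<^sup>n \<rtimes> S\<^sub>n)/(\<Delta>\<Gamma>\<^sup>n \<rtimes> {e\<^sub>0})\<close> with \<open>reduced_wreath\<close>.\<close>

lemma wreath_proj_identification: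
  assumes r: "r \<ge> 1"
  shows "wreath_proj r n ` carrier (wreath r n) = carrier (reduced_wreath r n)"
    and "kernel (wreath r n) (reduced_wreath r n) (wreath_proj r n) = diag_subgroup r n"
    and "(\<lambda>X. the_elem (wreath_proj r n ` X)) \<in> iso (wreath r n Mod diag_subgroup r n) (reduced_wreath r n)"
proof -
  interpret D: normal "Gam_diag r n" "Gam_pow r n" by (rule normal_Gam_diag) fact
  interpret h: group_hom "wreath r n" "reduced_wreath r n" "wreath_proj r n" by (rule wreath_proj_hom) fact
  show 1: "wreath_proj r n ` carrier (wreath r n) = carrier (reduced_wreath r n)"
    by (force simp: wreath_def reduced_wreath_def semidirect_def wreath_proj_def Gam_quot_def carrier_FactGroup)
  have c: "Gam_diag r n #>\<^bsub>Gam_pow r n\<^esub> g = Gam_diag r n \<longleftrightarrow> g \<in> Gam_diag r n" if "g \<in> carrier (Gam_pow r n)" for g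
    using D.coset_join1[OF _ that] D.coset_join2[OF that] D.subgroup_axioms D.subset by blast
  have c': "Gam_diag r n #>\<^bsub>Gam_pow r n\<^esub> g = Gam_diag r n" if "g \<in> Gam_diag r n" for g
    using c[OF D.mem_carrier[OF that]] that by simp
  have k: "(g, \<sigma>) \<in> kernel (wreath r n) (reduced_wreath r n) (wreath_proj r n) \<longleftrightarrow> (g, \<sigma>) \<in> diag_subgroup r n" for g \<sigma>
  proof
    assume "(g, \<sigma>) \<in> kernel (wreath r n) (reduced_wreath r n) (wreath_proj r n)"
    then show "(g, \<sigma>) \<in> diag_subgroup r n"
      using c[of g]
      by (simp add: kernel_def wreath_def reduced_wreath_def semidirect_def wreath_proj_def Gam_quot_def
          diag_subgroup_def sym_group_def)
  next
    assume "(g, \<sigma>) \<in> diag_subgroup r n"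
    then show "(g, \<sigma>) \<in> kernel (wreath r n) (reduced_wreath r n) (wreath_proj r n)"
      using D.mem_carrier[of g] c'[of g]
      by (simp add: kernel_def wreath_def reduced_wreath_def semidirect_def wreath_proj_def Gam_quot_def
          diag_subgroup_def sym_group_def permutes_id)
  qed
  show 2: "kernel (wreath r n) (reduced_wreath r n) (wreath_proj r n) = diag_subgroup r n"
    by (rule Set.set_eqI) (metis k prod.collapse)
  show "(\<lambda>X. the_elem (wreath_proj r n ` X)) \<in> iso (wreath r n Mod diag_subgroup r n) (reduced_wreath r n)"
    using h.FactGroup_iso_set[OF 1] by (simp add: 2)
qed


section \<open>The modules spanned by monomials\<close>

type_synonym cpoly = "(nat \<Rightarrow>\<^sub>0 nat) \<Rightarrow>\<^sub>0 complex"

definition var :: "nat \<Rightarrow> cpoly" where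
  "var i = Poly_Mapping.single (Poly_Mapping.single i 1) 1"

definition cscale :: "complex \<Rightarrow> cpoly \<Rightarrow> cpoly" where
  "cscale c p = Poly_Mapping.single 0 c * p"

text \<open>\<open>poly_subst y f\<close> is \<open>f(y\<^sub>1, y\<^sub>2, \<dots>)\<close>.\<close>

definition poly_subst :: "(nat \<Rightarrow> cpoly) \<Rightarrow> cpoly \<Rightarrow> cpoly" where
  "poly_subst y f = (\<Sum>m\<in>Poly_Mapping.keys f.
     cscale (Poly_Mapping.lookup f m)
       (\<Prod>i\<in>Poly_Mapping.keys m. y i ^ Poly_Mapping.lookup m i))"

text \<open>The sequence \<open>(0\<^bsup>k\<^sub>0\<^esup>, 1\<^bsup>k\<^sub>1\<^esup>, \<dots>)\<close>; a list is indexed from \<open>0\<close>, so its \<open>j\<close>-th entry \<open>\<lambda>\<^sub>j\<close>,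
  counted from \<open>1\<close>, is at position \<open>j - 1\<close>.\<close>

definition lam :: "nat list \<Rightarrow> nat list" where
  "lam k = concat (map (\<lambda>i. replicate (k ! i) i) [0..<length k])"

definition Mon :: "nat \<Rightarrow> nat list \<Rightarrow> cpoly set" where
  "Mon n k = {\<Prod>j\<in>{1..n}. var (\<sigma> j) ^ (lam k ! (j - 1)) | \<sigma>. \<sigma> permutes {1..n}}"

text \<open>The action is \<open>((g,\<sigma>) f)(x) = f((g,\<sigma>)\<^sup>-\<^sup>1 x)\<close> for the action
  \<open>((g,\<sigma>) x)\<^sub>i = g\<^sub>i x\<^bsub>\<sigma>\<^sup>-\<^sup>1(i)\<^esub>\<close> on points, that is,
  \<open>((g,\<sigma>) f)(x\<^sub>1, \<dots>, x\<^sub>n) = f(g\<^bsub>\<sigma>(1)\<^esub>\<^sup>-\<^sup>1 x\<^bsub>\<sigma>(1)\<^esub>, \<dots>, g\<^bsub>\<sigma>(n)\<^esub>\<^sup>-\<^sup>1 x\<^bsub>\<sigma>(n)\<^esub>)\<close>.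
  Replacing \<open>g\<^bsub>\<sigma>(i)\<^esub>\<close> by \<open>g\<^sub>i\<close> here gives the operator of \<open>(\<sigma>(g),\<sigma>) = (1,\<sigma>)(g,1)\<close> instead of
  \<open>(g,\<sigma>) = (g,1)(1,\<sigma>)\<close>; the two agree on \<open>\<Gamma>\<^sup>n\<close> and on \<open>S\<^sub>n\<close>, but only the present one is
  multiplicative for \<open>(g,\<sigma>)(h,\<tau>) = (g \<sigma>(h), \<sigma>\<tau>)\<close>.\<close>

definition CM :: "nat \<Rightarrow> nat list \<Rightarrow> ((nat \<Rightarrow> complex) \<times> (nat \<Rightarrow> nat), cpoly) crep" where
  "CM n k =
     \<lparr>rscale = cscale,
      rspace = Modules.module.span cscale (Mon n k),
      ract = (\<lambda>(g, \<sigma>). poly_subst (\<lambda>i. cscale (inverse (g (\<sigma> i))) (var (\<sigma> i))))\<rparr>"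

definition CM_reduced :: "nat \<Rightarrow> nat \<Rightarrow> nat list \<Rightarrow>
    ((nat \<Rightarrow> complex) set \<times> (nat \<Rightarrow> nat), cpoly) crep" where
  "CM_reduced r n k = descend (wreath r n) (wreath_proj r n) (CM n k)"

definition compositions :: "nat \<Rightarrow> nat \<Rightarrow> nat list set" where
  "compositions r n = {k. length k = r \<and> sum_list k = n}"

end

theory Submission
  imports Defs "HOL-Combinatorics.Multiset_Permutations"
begin

text \<open>
  On monomials, \<open>(g, \<sigma>)\<close> acts by permuting the exponent vector and multiplying by a character value
  of \<open>\<Gamma>\<^sup>n\<close>, and exponent vectors with entries below \<open>r\<close> correspond bijectively to the characters of
  \<open>\<Gamma>\<^sup>n\<close>. By orthogonality, averaging over \<open>\<Gamma>\<^sup>n\<close> projects a nonzero vector of an invariant subspace of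
  \<open>\<complex>M(\<^bold>k)\<close> onto a monomial, whose \<open>S\<^sub>n\<close>-orbit is the whole basis; comparing characters also shows that
  different \<open>\<^bold>k\<close> give non-isomorphic modules. The diagonal acts by the character of degree \<open>\<Sum> i k\<^sub>i\<close>.

  A function on \<open>(\<Gamma>\<^sup>n/\<Delta>\<Gamma>\<^sup>n \<rtimes> S\<^sub>n)/S\<^sub>n\<close> is a function on \<open>\<Gamma>\<^sup>n\<close> invariant under the diagonal. Evaluating
  polynomials at points of \<open>\<Gamma>\<^sup>n\<close> is equivariant, and Fourier inversion on \<open>\<Gamma>\<^sup>n\<close> shows that it maps
  the direct sum of the \<open>\<complex>M(\<^bold>k)\<close> with \<open>r\<close> dividing \<open>\<Sum> i k\<^sub>i\<close> bijectively onto these functions.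
\<close>

section \<open>Representations\<close>

text \<open>All facts about \<open>CM\<close> are read off coefficients. Viewing an exponent m as a
  function of the index, the coefficient of (g, sigma) p at m is that of p at m o sigma, divided by
  the value at g of the character with exponent m. The bound r on the exponents is essential: on
  Gamma the powers x^r and 1 coincide. Two features shape the rest. Points of the reduced group are
  cosets, so evaluating a polynomial there uses an arbitrary representative, and divisibility of the
  degree by r is what makes this choice harmless. And \<open>multiplicity_free\<close> asks for
  subspaces inside the representation, while the decomposition is an external sum of modules; the
  summands are therefore carried along the isomorphism, and their pairwise non-isomorphism keeps the
  images distinct.\<close>

lemma subspace_iff:
  assumes "vector_space s"
  shows "Modules.module.subspace s W \<longleftrightarrow>
    0 \<in> W \<and> (\<forall>u\<in>W. \<forall>v\<in>W. u + v \<in> W) \<and> (\<forall>c. \<forall>v\<in>W. s c v \<in> W)"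
proof -
  interpret vector_space s by fact
  show ?thesis by (simp add: subspace_def)
qed

lemma is_repD:
  assumes "is_rep G R"
  shows "Group.group G" "vector_space (rscale R)" "Modules.module.subspace (rscale R) (rspace R)"
    and "0 \<in> rspace R"
    and "\<And>u v. u \<in> rspace R \<Longrightarrow> v \<in> rspace R \<Longrightarrow> u + v \<in> rspace R"
    and "\<And>c v. v \<in> rspace R \<Longrightarrow> rscale R c v \<in> rspace R"
    and "\<And>g v. g \<in> carrier G \<Longrightarrow> v \<in> rspace R \<Longrightarrow> ract R g v \<in> rspace R"
    and "\<And>g u v. g \<in> carrier G \<Longrightarrow> u \<in> rspace R \<Longrightarrow> v \<in> rspace R \<Longrightarrow>
      ract R g (u + v) = ract R g u + ract R g v"
    and "\<And>g c v. g \<in> carrier G \<Longrightarrow> v \<in> rspace R \<Longrightarrow> ract R g (rscale R c v) = rscale R c (ract R g v)"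
    and "\<And>v. v \<in> rspace R \<Longrightarrow> ract R \<one>\<^bsub>G\<^esub> v = v"
    and "\<And>g h v. g \<in> carrier G \<Longrightarrow> h \<in> carrier G \<Longrightarrow> v \<in> rspace R \<Longrightarrow>
      ract R (g \<otimes>\<^bsub>G\<^esub> h) v = ract R g (ract R h v)"
proof -
  show "Group.group G" and vs: "vector_space (rscale R)"
    and sub: "Modules.module.subspace (rscale R) (rspace R)"
    using assms by (auto simp: is_rep_def)
  show "0 \<in> rspace R"
    "\<And>u v. u \<in> rspace R \<Longrightarrow> v \<in> rspace R \<Longrightarrow> u + v \<in> rspace R"
    "\<And>c v. v \<in> rspace R \<Longrightarrow> rscale R c v \<in> rspace R"
    using sub unfolding subspace_iff[OF vs] by auto
qed (use assms in \<open>auto simp: is_rep_def linear_map_on_def image_subset_iff\<close>)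

lemma is_repI:
  assumes "Group.group G" and vs: "vector_space (rscale R)"
    and "0 \<in> rspace R"
    and "\<And>u v. u \<in> rspace R \<Longrightarrow> v \<in> rspace R \<Longrightarrow> u + v \<in> rspace R"
    and "\<And>c v. v \<in> rspace R \<Longrightarrow> rscale R c v \<in> rspace R"
    and "\<And>g v. g \<in> carrier G \<Longrightarrow> v \<in> rspace R \<Longrightarrow> ract R g v \<in> rspace R"
    and "\<And>g u v. g \<in> carrier G \<Longrightarrow> u \<in> rspace R \<Longrightarrow> v \<in> rspace R \<Longrightarrow>
      ract R g (u + v) = ract R g u + ract R g v"
    and "\<And>g c v. g \<in> carrier G \<Longrightarrow> v \<in> rspace R \<Longrightarrow> ract R g (rscale R c v) = rscale R c (ract R g v)"
    and "\<And>v. v \<in> rspace R \<Longrightarrow> ract R \<one>\<^bsub>G\<^esub> v = v"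
    and "\<And>g h v. g \<in> carrier G \<Longrightarrow> h \<in> carrier G \<Longrightarrow> v \<in> rspace R \<Longrightarrow>
      ract R (g \<otimes>\<^bsub>G\<^esub> h) v = ract R g (ract R h v)"
  shows "is_rep G R"
  unfolding is_rep_def subspace_iff[OF vs] linear_map_on_def
  by (intro conjI ballI allI image_subsetI) (rule assms; assumption?)+

text \<open>T is linear only on V, so the partial sums have to stay in V; this is where the subspace
  assumption enters.\<close>

lemma linear_map_on_sum:
  assumes "vector_space s1" "vector_space s2" "linear_map_on s1 s2 V T"
    and V: "Modules.module.subspace s1 V" and f: "\<And>i. i \<in> A \<Longrightarrow> f i \<in> V"
  shows "T (\<Sum>i\<in>A. f i) = (\<Sum>i\<in>A. T (f i))"
proof -
  interpret s1: vector_space s1 by fact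
  interpret s2: vector_space s2 by fact
  have T0: "T 0 = 0"
    using assms(3) s1.subspace_0[OF V] unfolding linear_map_on_def
    by (metis s1.scale_zero_left s2.scale_zero_left)
  show ?thesis
    using f
  proof (induction A rule: infinite_finite_induct)
    case (insert x F)
    have "(\<Sum>i\<in>F. f i) \<in> V" using insert.prems by (intro s1.subspace_sum[OF V]) auto
    then show ?case using insert assms(3) by (simp add: linear_map_on_def)
  qed (simp_all add: T0)
qed

text \<open>The axioms of \<open>is_rep\<close> for S beyond its scaling are inherited, since each
  element of \<open>rspace S\<close> is some \<open>T v\<close>. A space such as that of
  \<open>induced_rep\<close> then needs no separate verification.\<close>

lemma rep_iso_transport:
  assumes R: "is_rep G R" and vs: "vector_space (rscale S)"
    and bij: "bij_betw T (rspace R) (rspace S)"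
    and lin: "linear_map_on (rscale R) (rscale S) (rspace R) T"
    and eqv: "\<And>g v. g \<in> carrier G \<Longrightarrow> v \<in> rspace R \<Longrightarrow> T (ract R g v) = ract S g (T v)"
  shows "rep_iso G R S"
proof -
  note D = is_repD[OF R]
  interpret G: Group.group G by (rule D(1))
  interpret s1: vector_space "rscale R" by (rule D(2))
  interpret s2: vector_space "rscale S" by fact
  have sp: "rspace S = T ` rspace R" using bij by (simp add: bij_betw_def)
  have Tadd: "T u + T v = T (u + v)" if "u \<in> rspace R" "v \<in> rspace R" for u v
    using lin that by (simp add: linear_map_on_def)
  have Tsc: "rscale S c (T v) = T (rscale R c v)" if "v \<in> rspace R" for c v
    using lin that by (simp add: linear_map_on_def)
  have T0: "T 0 = 0" using Tsc[OF D(4), of 0] by simp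
  have "is_rep G S"
  proof (rule is_repI[OF D(1) vs])
    show "0 \<in> rspace S" unfolding sp using T0 D(4) by (metis image_eqI)
  qed (auto simp: sp Tadd Tsc D eqv[symmetric])
  then show ?thesis using assms unfolding rep_iso_def by blast
qed

lemma rep_iso_sym:
  assumes "rep_iso G R S"
  shows "rep_iso G S R"
proof -
  obtain T where R: "is_rep G R" and S: "is_rep G S"
    and bij: "bij_betw T (rspace R) (rspace S)"
    and lin: "linear_map_on (rscale R) (rscale S) (rspace R) T"
    and eqv: "\<And>g v. g \<in> carrier G \<Longrightarrow> v \<in> rspace R \<Longrightarrow> T (ract R g v) = ract S g (T v)"
    using assms unfolding rep_iso_def by blast
  note D = is_repD[OF R]
  define U where "U = inv_into (rspace R) T"
  have UT: "U (T v) = v" if "v \<in> rspace R" for v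
    using bij that by (simp add: U_def bij_betw_inv_into_left)
  have sp: "rspace S = T ` rspace R" using bij by (simp add: bij_betw_def)
  have Tadd: "T u + T v = T (u + v)" if "u \<in> rspace R" "v \<in> rspace R" for u v
    using lin that by (simp add: linear_map_on_def)
  have Tsc: "rscale S c (T v) = T (rscale R c v)" if "v \<in> rspace R" for c v
    using lin that by (simp add: linear_map_on_def)
  show ?thesis
  proof (rule rep_iso_transport[OF S D(2)])
    show "bij_betw U (rspace S) (rspace R)" unfolding U_def by (rule bij_betw_inv_into[OF bij])
    show "linear_map_on (rscale S) (rscale R) (rspace S) U"
      by (auto simp: linear_map_on_def sp Tadd Tsc UT D)
    show "U (ract S g v) = ract R g (U v)" if "g \<in> carrier G" "v \<in> rspace S" for g v
      using that by (auto simp: sp eqv[symmetric] UT D)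
  qed
qed

lemma rep_iso_trans:
  assumes "rep_iso G R S" "rep_iso G S Q"
  shows "rep_iso G R Q"
proof -
  obtain T where R: "is_rep G R" "is_rep G S"
    and T: "bij_betw T (rspace R) (rspace S)" "linear_map_on (rscale R) (rscale S) (rspace R) T"
    "\<And>g v. g \<in> carrier G \<Longrightarrow> v \<in> rspace R \<Longrightarrow> T (ract R g v) = ract S g (T v)"
    using assms(1) unfolding rep_iso_def by blast
  obtain U where Q: "is_rep G Q"
    and U: "bij_betw U (rspace S) (rspace Q)" "linear_map_on (rscale S) (rscale Q) (rspace S) U"
    "\<And>g v. g \<in> carrier G \<Longrightarrow> v \<in> rspace S \<Longrightarrow> U (ract S g v) = ract Q g (U v)"
    using assms(2) unfolding rep_iso_def by blast
  have mem: "T v \<in> rspace S" if "v \<in> rspace R" for v using T(1) that by (auto simp: bij_betw_def)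
  show ?thesis
  proof (rule rep_iso_transport[OF R(1) is_repD(2)[OF Q]])
    show "bij_betw (U \<circ> T) (rspace R) (rspace Q)" by (rule bij_betw_trans[OF T(1) U(1)])
    show "linear_map_on (rscale R) (rscale Q) (rspace R) (U \<circ> T)"
      using T(2) U(2) mem by (simp add: linear_map_on_def)
  qed (simp add: T(3) U(3) mem)
qed

lemma irreducible_rep_iso:
  assumes iso: "rep_iso G R S" and irr: "irreducible_rep G R"
  shows "irreducible_rep G S"
proof -
  obtain T where R: "is_rep G R" and S: "is_rep G S"
    and bij: "bij_betw T (rspace R) (rspace S)"
    and lin: "linear_map_on (rscale R) (rscale S) (rspace R) T"
    and eqv: "\<And>g v. g \<in> carrier G \<Longrightarrow> v \<in> rspace R \<Longrightarrow> T (ract R g v) = ract S g (T v)"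
    using iso unfolding rep_iso_def by blast
  note D = is_repD[OF R] and E = is_repD[OF S]
  interpret s1: vector_space "rscale R" by (rule D(2))
  interpret s2: vector_space "rscale S" by (rule E(2))
  have sp: "rspace S = T ` rspace R" and inj: "inj_on T (rspace R)"
    using bij by (auto simp: bij_betw_def)
  have Tadd: "T (u + v) = T u + T v" if "u \<in> rspace R" "v \<in> rspace R" for u v
    using lin that by (simp add: linear_map_on_def)
  have Tsc: "T (rscale R c v) = rscale S c (T v)" if "v \<in> rspace R" for c v
    using lin that by (simp add: linear_map_on_def)
  have T0: "T 0 = 0" using Tsc[OF D(4), of 0] by simp
  obtain v where v: "v \<in> rspace R" "v \<noteq> 0"
    using irr D(4) by (auto simp: irreducible_rep_def)
  have "T v \<noteq> 0" using inj_onD[OF inj _ v(1) D(4)] v(2) T0 by auto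
  then have "rspace S \<noteq> {0}" using v(1) by (auto simp: sp)
  moreover have "W = {0} \<or> W = rspace S"
    if W: "W \<subseteq> rspace S" "Modules.module.subspace (rscale S) W"
      and inv: "\<forall>g\<in>carrier G. ract S g ` W \<subseteq> W" for W
  proof -
    \<comment> \<open>The preimage of an invariant subspace is invariant, and T maps it back onto W
      because W lies in the image of T.\<close>
    define V where "V = {v \<in> rspace R. T v \<in> W}"
    have W_eq: "W = T ` V" using W(1) by (auto simp: V_def sp)
    have sub: "Modules.module.subspace (rscale R) V"
      using W(2) unfolding subspace_iff[OF D(2)] subspace_iff[OF E(2)]
      by (auto simp: V_def D T0 Tadd Tsc)
    have "ract R g ` V \<subseteq> V" if "g \<in> carrier G" for g
      using inv that by (fastforce simp: V_def D eqv)
    moreover have "V \<subseteq> rspace R" by (auto simp: V_def)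
    ultimately have "V = {0} \<or> V = rspace R" using irr sub by (simp add: irreducible_rep_def)
    then show ?thesis by (auto simp: W_eq sp T0)
  qed
  ultimately show ?thesis using S by (simp add: irreducible_rep_def)
qed

section \<open>Descent of representations along a surjective homomorphism\<close>

lemma descend_sel [simp]:
  "rscale (descend G \<pi> R) = rscale R" "rspace (descend G \<pi> R) = rspace R"
  by (simp_all add: descend_def)

text \<open>\<open>descend\<close> acts through the preimage y chosen by \<open>inv_into\<close>; y
  differs from x by a kernel element z, which acts as the identity.\<close>

lemma ract_descend:
  assumes hom: "group_hom G H \<pi>" and R: "is_rep G R"
    and triv: "acts_trivially (kernel G H \<pi>) R"
    and x: "x \<in> carrier G" and v: "v \<in> rspace R"
  shows "ract (descend G \<pi> R) (\<pi> x) v = ract R x v"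
proof -
  interpret group_hom G H \<pi> by fact
  define y where "y = inv_into (carrier G) \<pi> (\<pi> x)"
  have y: "y \<in> carrier G" "\<pi> y = \<pi> x"
    using x by (auto simp: y_def inv_into_into f_inv_into_f)
  define z where "z = inv\<^bsub>G\<^esub> x \<otimes>\<^bsub>G\<^esub> y"
  have "\<pi> z = \<one>\<^bsub>H\<^esub>" using x y by (simp add: z_def)
  then have z: "z \<in> kernel G H \<pi>" "z \<in> carrier G" using x y by (auto simp: kernel_def z_def)
  have "y = x \<otimes>\<^bsub>G\<^esub> z" using x y by (simp add: z_def G.m_assoc[symmetric])
  then have "ract R y v = ract R x (ract R z v)" using is_repD(11)[OF R x z(2) v] by simp
  also have "ract R z v = v" using triv z v by (simp add: acts_trivially_def)
  finally show ?thesis by (simp add: descend_def y_def)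
qed

lemma is_rep_descend:
  assumes hom: "group_hom G H \<pi>" and surj: "\<pi> ` carrier G = carrier H" and R: "is_rep G R"
    and triv: "acts_trivially (kernel G H \<pi>) R"
  shows "is_rep H (descend G \<pi> R)"
proof -
  interpret group_hom G H \<pi> by fact
  note act = ract_descend[OF hom R triv] and D = is_repD[OF R]
  have ob: "\<exists>x\<in>carrier G. y = \<pi> x" if "y \<in> carrier H" for y using surj that by blast
  show ?thesis
  proof (rule is_repI)
    show "ract (descend G \<pi> R) \<one>\<^bsub>H\<^esub> v = v" if "v \<in> rspace (descend G \<pi> R)" for v
      using act[OF G.one_closed, of v] that D by simp
    show "ract (descend G \<pi> R) (g \<otimes>\<^bsub>H\<^esub> h) v = ract (descend G \<pi> R) g (ract (descend G \<pi> R) h v)"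
      if gh: "g \<in> carrier H" "h \<in> carrier H" and "v \<in> rspace (descend G \<pi> R)" for g h v
    proof -
      obtain x y where xy: "x \<in> carrier G" "g = \<pi> x" "y \<in> carrier G" "h = \<pi> y"
        using ob gh by meson
      then show ?thesis using that act[of "x \<otimes>\<^bsub>G\<^esub> y" v] by (simp add: act D)
    qed
  qed (use D in \<open>auto dest!: ob simp: act\<close>)
qed

text \<open>A kernel element has the image of the unit, where any descended action is the identity.
  For the converse, \<open>descend\<close> is the witness.\<close>

lemma descends_to_iff:
  assumes hom: "group_hom G H \<pi>" and surj: "\<pi> ` carrier G = carrier H" and R: "is_rep G R"
  shows "descends_to G H \<pi> R \<longleftrightarrow> acts_trivially (kernel G H \<pi>) R"
proof
  assume "descends_to G H \<pi> R"
  then show "acts_trivially (kernel G H \<pi>) R"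
    unfolding descends_to_def acts_trivially_def kernel_def is_rep_def by fastforce
next
  assume triv: "acts_trivially (kernel G H \<pi>) R"
  have "is_rep H \<lparr>rscale = rscale R, rspace = rspace R, ract = ract (descend G \<pi> R)\<rparr>"
    using is_rep_descend[OF hom surj R triv] by (simp add: descend_def)
  then show "descends_to G H \<pi> R"
    unfolding descends_to_def using ract_descend[OF hom R triv] by blast
qed

text \<open>x and \<open>\<pi> x\<close> act by the same operator, so a subspace invariant under H
  is invariant under G.\<close>

lemma irreducible_rep_descend:
  assumes hom: "group_hom G H \<pi>" and surj: "\<pi> ` carrier G = carrier H"
    and irr: "irreducible_rep G R" and triv: "acts_trivially (kernel G H \<pi>) R"
  shows "irreducible_rep H (descend G \<pi> R)"
proof -
  interpret group_hom G H \<pi> by fact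
  have R: "is_rep G R" using irr by (simp add: irreducible_rep_def)
  note act = ract_descend[OF hom R triv]
  have "W = {0} \<or> W = rspace R"
    if W: "W \<subseteq> rspace R" "Modules.module.subspace (rscale R) W"
      and inv: "\<forall>h\<in>carrier H. ract (descend G \<pi> R) h ` W \<subseteq> W" for W
  proof -
    have "ract R x ` W \<subseteq> W" if "x \<in> carrier G" for x
    proof -
      have "ract R x ` W = ract (descend G \<pi> R) (\<pi> x) ` W"
        using W(1) by (intro image_cong) (auto simp: act that)
      then show ?thesis using inv that by simp
    qed
    then show ?thesis using irr W by (simp add: irreducible_rep_def)
  qed
  then show ?thesis
    using is_rep_descend[OF hom surj R triv] irr by (simp add: irreducible_rep_def)
qed

text \<open>An intertwiner over H is one over G after pulling back. Non-isomorphism of the reduced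
  modules can thus be tested over the full wreath product, where Gamma^n acts on coefficients by
  characters.\<close>

lemma rep_iso_descend:
  assumes hom: "group_hom G H \<pi>" and R: "is_rep G R" and S: "is_rep G S"
    and triv: "acts_trivially (kernel G H \<pi>) R" "acts_trivially (kernel G H \<pi>) S"
    and iso: "rep_iso H (descend G \<pi> R) (descend G \<pi> S)"
  shows "rep_iso G R S"
proof -
  interpret group_hom G H \<pi> by fact
  obtain T where T: "bij_betw T (rspace R) (rspace S)"
    "linear_map_on (rscale R) (rscale S) (rspace R) T"
    "\<And>g v. g \<in> carrier H \<Longrightarrow> v \<in> rspace R \<Longrightarrow>
       T (ract (descend G \<pi> R) g v) = ract (descend G \<pi> S) g (T v)"
    using iso unfolding rep_iso_def by auto
  show ?thesis
  proof (rule rep_iso_transport[OF R is_repD(2)[OF S] T(1,2)])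
    fix x v assume xv: "x \<in> carrier G" "v \<in> rspace R"
    then have "T v \<in> rspace S" using T(1) by (auto simp: bij_betw_def)
    then show "T (ract R x v) = ract S x (T v)"
      using T(3)[of "\<pi> x" v] xv
      by (simp add: ract_descend[OF hom R triv(1)] ract_descend[OF hom S triv(2)])
  qed
qed

section \<open>External direct sums and multiplicity-freeness\<close>

lemma vector_space_pointwise:
  fixes s :: "'i \<Rightarrow> 'a::field \<Rightarrow> 'v::ab_group_add \<Rightarrow> 'v"
  assumes "\<And>i. vector_space (s i)"
  shows "vector_space (\<lambda>c f i. s i c (f i))"
proof
  fix a b :: 'a and f g :: "'i \<Rightarrow> 'v"
  show "(\<lambda>i. s i a ((f + g) i)) = (\<lambda>i. s i a (f i)) + (\<lambda>i. s i a (g i))"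
    and "(\<lambda>i. s i (a + b) (f i)) = (\<lambda>i. s i a (f i)) + (\<lambda>i. s i b (f i))"
    and "(\<lambda>i. s i a (s i b (f i))) = (\<lambda>i. s i (a * b) (f i))"
    and "(\<lambda>i. s i 1 (f i)) = f"
    using assms by (auto simp: fun_eq_iff vector_space_def)
qed

lemma rep_direct_sum_sel [simp]:
  "rscale (rep_direct_sum I S) = (\<lambda>c f i. rscale (S i) c (f i))"
  "ract (rep_direct_sum I S) = (\<lambda>g f i. if i \<in> I then ract (S i) g (f i) else 0)"
  by (simp_all add: rep_direct_sum_def)

lemma rspace_rep_direct_sum:
  fixes S :: "'i \<Rightarrow> ('g, 'v::ab_group_add) crep"
  assumes "finite I"
  shows "rspace (rep_direct_sum I S) = {f. (\<forall>i\<in>I. f i \<in> rspace (S i)) \<and> (\<forall>i. i \<notin> I \<longrightarrow> f i = 0)}"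
proof -
  have "finite {i. f i \<noteq> 0}" if "\<forall>i. i \<notin> I \<longrightarrow> f i = 0" for f :: "'i \<Rightarrow> 'v"
    using that by (intro finite_subset[OF _ assms]) auto
  then show ?thesis by (auto simp: rep_direct_sum_def)
qed

text \<open>The direct sum scales every coordinate by \<open>rscale (S i)\<close>, also those
  outside I; hence the vector space hypothesis ranges over all indices.\<close>

lemma is_rep_direct_sum:
  assumes I: "finite I" and G: "Group.group G" and vs: "\<And>i. vector_space (rscale (S i))"
    and S: "\<And>i. i \<in> I \<Longrightarrow> is_rep G (S i)"
  shows "is_rep G (rep_direct_sum I S)"
proof -
  interpret v: vector_space "rscale (S i)" for i by (rule vs)
  show ?thesis
  proof (rule is_repI[OF G])
    show "vector_space (rscale (rep_direct_sum I S))"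
      using vector_space_pointwise[OF vs] by simp
  qed (auto simp: rspace_rep_direct_sum[OF I] fun_eq_iff is_repD[OF S] G Group.group.is_monoid)
qed

lemma sum_apply: "(\<Sum>i\<in>A. f i) x = (\<Sum>i\<in>A. f i x :: 'b::comm_monoid_add)"
  by (induction A rule: infinite_finite_induct) simp_all

text \<open>The required subspaces are the images under T of the coordinate copies of the
  \<open>S i\<close>. Non-isomorphism makes W injective on I, so a sum over the set of subspaces is
  a sum over I, and unique decomposition is the bijectivity of T.\<close>

lemma multiplicity_free_direct_sum:
  fixes R :: "('g, 'v::ab_group_add) crep" and S :: "'i \<Rightarrow> ('g, 'w::ab_group_add) crep"
  assumes dec: "decomposes_into_irreducibles G R I S"
    and noniso: "\<And>i j. i \<in> I \<Longrightarrow> j \<in> I \<Longrightarrow> rep_iso G (S i) (S j) \<Longrightarrow> i = j"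
  shows "multiplicity_free G R"
proof -
  have I: "finite I" and irr: "\<And>i. i \<in> I \<Longrightarrow> irreducible_rep G (S i)"
    and iso: "rep_iso G (rep_direct_sum I S) R"
    using dec rep_iso_sym by (auto simp: decomposes_into_irreducibles_def)
  let ?D = "rep_direct_sum I S"
  note sp = rspace_rep_direct_sum[OF I, of S]
  obtain T where DS: "is_rep G ?D" and R: "is_rep G R"
    and bij: "bij_betw T (rspace ?D) (rspace R)"
    and lin: "linear_map_on (rscale ?D) (rscale R) (rspace ?D) T"
    and eqv: "\<And>g v. g \<in> carrier G \<Longrightarrow> v \<in> rspace ?D \<Longrightarrow> T (ract ?D g v) = ract R g (T v)"
    using iso unfolding rep_iso_def by blast
  have S: "is_rep G (S i)" if "i \<in> I" for i using irr[OF that] by (simp add: irreducible_rep_def)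
  define emb :: "'i \<Rightarrow> 'w \<Rightarrow> 'i \<Rightarrow> 'w" where "emb = (\<lambda>i v j. if j = i then v else 0)"
  have vsR: "vector_space (rscale R)" and vsD: "vector_space (rscale ?D)"
    using is_repD(2)[OF R] is_repD(2)[OF DS] by auto
  interpret d: vector_space "rscale ?D" by (rule vsD)
  \<comment> \<open>Outside I nothing is known about \<open>S i\<close> itself, so this is extracted
    from the vector space structure of the whole sum.\<close>
  have z: "rscale (S i) c 0 = 0" for i c
    using d.scale_zero_right[of c] by (simp add: fun_eq_iff)
  have emb: "emb i v \<in> rspace ?D" if "i \<in> I" "v \<in> rspace (S i)" for i v
    using that is_repD(4)[OF S] by (auto simp: sp emb_def)
  have emb_sum: "f = (\<Sum>i\<in>I. emb i (f i))" if "f \<in> rspace ?D" for f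
  proof
    fix j show "f j = (\<Sum>i\<in>I. emb i (f i)) j"
      using that I by (cases "j \<in> I") (auto simp: emb_def sp sum_apply)
  qed
  define W where "W i = T ` emb i ` rspace (S i)" for i
  have W_iso: "rep_iso G (S i) (R\<lparr>rspace := W i\<rparr>)" if i: "i \<in> I" for i
  proof (rule rep_iso_transport[OF S[OF i]])
    show "bij_betw (T \<circ> emb i) (rspace (S i)) (rspace (R\<lparr>rspace := W i\<rparr>))"
      unfolding bij_betw_def
    proof
      show "inj_on (T \<circ> emb i) (rspace (S i))"
      proof (rule comp_inj_on)
        show "inj_on (emb i) (rspace (S i))"
          by (rule inj_onI) (metis emb_def)
        show "inj_on T (emb i ` rspace (S i))"
          using bij emb[OF i] by (auto simp: bij_betw_def intro: inj_on_subset)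
      qed
    qed (auto simp: W_def)
    have "emb i (u + v) = emb i u + emb i v" "emb i (rscale (S i) c u) = rscale ?D c (emb i u)" for u v c
      using z by (auto simp: emb_def fun_eq_iff)
    then show "linear_map_on (rscale (S i)) (rscale (R\<lparr>rspace := W i\<rparr>)) (rspace (S i)) (T \<circ> emb i)"
      using lin emb[OF i] by (simp add: linear_map_on_def)
    fix g v assume gv: "g \<in> carrier G" "v \<in> rspace (S i)"
    \<comment> \<open>The direct sum applies every \<open>S j\<close> to its own coordinate, so the
      zero coordinates of \<open>emb i v\<close> must be seen to stay zero.\<close>
    have "ract (S j) g 0 = 0" if "j \<in> I" for j
    proof -
      interpret vector_space "rscale (S j)" by (rule is_repD(2)[OF S[OF that]])
      show ?thesis using is_repD(9)[OF S[OF that] gv(1) is_repD(4)[OF S[OF that]], of 0] by simp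
    qed
    then have "emb i (ract (S i) g v) = ract ?D g (emb i v)"
      using i by (auto simp: emb_def fun_eq_iff)
    then show "(T \<circ> emb i) (ract (S i) g v) = ract (R\<lparr>rspace := W i\<rparr>) g ((T \<circ> emb i) v)"
      using eqv[OF gv(1) emb[OF i gv(2)]] by simp
  qed (simp add: vsR)
  have W_eq: "i = j" if "i \<in> I" "j \<in> I" "rep_iso G (R\<lparr>rspace := W i\<rparr>) (R\<lparr>rspace := W j\<rparr>)" for i j
    using noniso[OF that(1,2)] rep_iso_trans[OF rep_iso_trans[OF W_iso[OF that(1)] that(3)]
        rep_iso_sym[OF W_iso[OF that(2)]]] by simp
  have inj: "inj_on W I"
  proof (rule inj_onI)
    fix i j assume ij: "i \<in> I" "j \<in> I" "W i = W j"
    \<comment> \<open>Reflexivity is obtained by passing to \<open>S i\<close> and back.\<close>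
    have "rep_iso G (R\<lparr>rspace := W i\<rparr>) (R\<lparr>rspace := W i\<rparr>)"
      using rep_iso_trans[OF rep_iso_sym W_iso] W_iso ij(1) by blast
    then show "i = j" using W_eq[OF ij(1,2)] ij(3) by simp
  qed
  have T_sum: "T f = (\<Sum>i\<in>I. T (emb i (f i)))" if f: "f \<in> rspace ?D" for f
  proof -
    have "emb i (f i) \<in> rspace ?D" if "i \<in> I" for i using f that by (intro emb) (auto simp: sp)
    then show ?thesis
      by (subst emb_sum[OF f], subst linear_map_on_sum[OF vsD vsR lin is_repD(3)[OF DS]]) auto
  qed
  have "\<exists>!w. w \<in> (\<Pi>\<^sub>E X\<in>W ` I. X) \<and> v = (\<Sum>X\<in>W ` I. w X)" if v: "v \<in> rspace R" for v
  proof -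
    obtain f where f: "f \<in> rspace ?D" "v = T f" using bij v by (auto simp: bij_betw_def)
    \<comment> \<open>The family is indexed by subspaces, and \<open>inv_into\<close> recovers the
      index i from \<open>W i\<close>.\<close>
    define w where "w = (\<lambda>X\<in>W ` I. T (emb (inv_into I W X) (f (inv_into I W X))))"
    have wW: "w (W i) = T (emb i (f i))" if "i \<in> I" for i
      using that inj by (simp add: w_def)
    have w1: "w \<in> (\<Pi>\<^sub>E X\<in>W ` I. X)"
      using f(1) wW by (auto simp: PiE_iff W_def sp w_def)
    have w2: "v = (\<Sum>X\<in>W ` I. w X)"
      using T_sum[OF f(1)] by (simp add: sum.reindex[OF inj] wW f(2))
    have w3: "w' = w" if w': "w' \<in> (\<Pi>\<^sub>E X\<in>W ` I. X)" "v = (\<Sum>X\<in>W ` I. w' X)" for w'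
    proof -
      have "\<forall>i\<in>I. \<exists>u\<in>rspace (S i). w' (W i) = T (emb i u)"
        using w'(1) by (auto simp: PiE_iff W_def image_iff)
      then obtain u where u: "\<And>i. i \<in> I \<Longrightarrow> u i \<in> rspace (S i)" "\<And>i. i \<in> I \<Longrightarrow> w' (W i) = T (emb i (u i))"
        by metis
      \<comment> \<open>Another decomposition of v reassembles to an element of the direct sum with
        the same image, so injectivity of T identifies the two.\<close>
      define f' where "f' = (\<lambda>i. if i \<in> I then u i else 0)"
      have f': "f' \<in> rspace ?D" using u by (auto simp: sp f'_def)
      have "T f' = v" using T_sum[OF f'] w'(2) by (simp add: sum.reindex[OF inj] u(2) f'_def)
      then have "f' = f" using bij f f' by (auto simp: bij_betw_def dest: inj_onD)
      then have "w' X = w X" if "X \<in> W ` I" for X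
        using that wW u(2) by (auto simp: f'_def)
      then show ?thesis
        using w'(1) w1 by (intro PiE_ext) auto
    qed
    show ?thesis by (rule ex1I[of _ w]) (simp_all only: w1 w2[symmetric] w3 simp_thms)
  qed
  then have "\<forall>v\<in>rspace R. \<exists>!w. w \<in> (\<Pi>\<^sub>E X\<in>W ` I. X) \<and> v = (\<Sum>X\<in>W ` I. w X)" ..
  moreover have "W i \<subseteq> rspace R" if "i \<in> I" for i
    using emb[OF that] bij by (auto simp: W_def bij_betw_def)
  then have "\<forall>X\<in>W ` I. X \<subseteq> rspace R \<and> irreducible_rep G (R\<lparr>rspace := X\<rparr>)"
    using irreducible_rep_iso[OF W_iso irr] by auto
  moreover have "\<forall>X\<in>W ` I. \<forall>X'\<in>W ` I. X \<noteq> X' \<longrightarrow> \<not> rep_iso G (R\<lparr>rspace := X\<rparr>) (R\<lparr>rspace := X'\<rparr>)"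
    using W_eq by auto
  ultimately show ?thesis
    unfolding multiplicity_free_def
    by (intro conjI exI[of _ "W ` I"]) (simp_all only: R finite_imageI[OF I])
qed

section \<open>Functions on cosets and induction from the trivial representation\<close>

lemma is_rep_permutation_rep:
  assumes G: "Group.group G" and K: "subgroup K G"
  shows "is_rep G (permutation_rep G K)"
proof -
  interpret Group.group G by fact
  interpret K: subgroup K G by fact
  have sub: "C \<subseteq> carrier G" if "C \<in> lcosets\<^bsub>G\<^esub> K" for C
    using K.lcosets_carrier[OF G that] .
  have mem: "g <#\<^bsub>G\<^esub> C \<in> lcosets\<^bsub>G\<^esub> K" if "g \<in> carrier G" "C \<in> lcosets\<^bsub>G\<^esub> K" for g C
    using that K.subset by (auto simp: LCOSETS_def lcos_m_assoc)
  show ?thesis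
  proof (rule is_repI[OF G])
    show "vector_space (rscale (permutation_rep G K))"
      by standard (auto simp: permutation_rep_def fun_eq_iff algebra_simps)
    show "ract (permutation_rep G K) \<one>\<^bsub>G\<^esub> v = v" if "v \<in> rspace (permutation_rep G K)" for v
      using that sub by (auto simp: permutation_rep_def fun_eq_iff lcos_mult_one)
    show "ract (permutation_rep G K) (g \<otimes>\<^bsub>G\<^esub> h) v =
        ract (permutation_rep G K) g (ract (permutation_rep G K) h v)"
      if "g \<in> carrier G" "h \<in> carrier G" for g h v
      using that sub mem by (auto simp: permutation_rep_def fun_eq_iff inv_mult_group lcos_m_assoc)
  qed (auto simp: permutation_rep_def fun_eq_iff)
qed

text \<open>Pulling a function on left cosets back along x to xK gives the functions on G constant
  on each xK; for the trivial representation this is the defining condition of the induced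
  space.\<close>

lemma rep_iso_permutation_induced:
  assumes G: "Group.group G" and K: "subgroup K G"
  shows "rep_iso G (permutation_rep G K) (induced_rep G K trivial_rep)"
proof -
  interpret Group.group G by fact
  interpret K: subgroup K G by fact
  let ?P = "permutation_rep G K" and ?N = "induced_rep G K trivial_rep"
  define T :: "('a set \<Rightarrow> complex) \<Rightarrow> 'a \<Rightarrow> complex"
    where "T = (\<lambda>F x. if x \<in> carrier G then F (x <#\<^bsub>G\<^esub> K) else 0)"
  have mem: "x <#\<^bsub>G\<^esub> K \<in> lcosets\<^bsub>G\<^esub> K" if "x \<in> carrier G" for x using that by (auto simp: LCOSETS_def)
  have absorb: "(x \<otimes>\<^bsub>G\<^esub> k) <#\<^bsub>G\<^esub> K = x <#\<^bsub>G\<^esub> K" if "x \<in> carrier G" "k \<in> K" for x k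
    using lcos_m_assoc[of K x k] coset_join3[of k K] K that K.subset by auto
  show ?thesis
  proof (rule rep_iso_transport[OF is_rep_permutation_rep[OF G K]])
    show "vector_space (rscale ?N)"
      by standard (auto simp: induced_rep_def trivial_rep_def fun_eq_iff algebra_simps)
    show "bij_betw T (rspace ?P) (rspace ?N)"
      unfolding bij_betw_def
    proof
      show "inj_on T (rspace ?P)"
      proof (rule inj_onI)
        fix F F' assume F: "F \<in> rspace ?P" "F' \<in> rspace ?P" "T F = T F'"
        show "F = F'"
        proof
          fix C show "F C = F' C"
          proof (cases "C \<in> lcosets\<^bsub>G\<^esub> K")
            case True
            then obtain x where "x \<in> carrier G" "C = x <#\<^bsub>G\<^esub> K" by (auto simp: LCOSETS_def)
            then show ?thesis using fun_cong[OF F(3), of x] by (simp add: T_def)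
          qed (use F in \<open>auto simp: permutation_rep_def\<close>)
        qed
      qed
      show "T ` rspace ?P = rspace ?N"
      proof (rule Set.set_eqI, rule iffI)
        fix f assume "f \<in> T ` rspace ?P"
        then show "f \<in> rspace ?N"
          by (auto simp: induced_rep_def trivial_rep_def T_def absorb)
      next
        fix f assume f: "f \<in> rspace ?N"
        \<comment> \<open>f takes one value on a whole coset, so any representative may be
          chosen.\<close>
        define F where "F C = (if C \<in> lcosets\<^bsub>G\<^esub> K then f (SOME x. x \<in> C) else 0)" for C
        have "f (SOME y. y \<in> x <#\<^bsub>G\<^esub> K) = f x" if x: "x \<in> carrier G" for x
        proof -
          have "(SOME y. y \<in> x <#\<^bsub>G\<^esub> K) \<in> x <#\<^bsub>G\<^esub> K"
            using lcos_self[OF x K] by (rule someI)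
          then show ?thesis
            using f x by (auto simp: l_coset_def induced_rep_def trivial_rep_def)
        qed
        then have "T F = f"
          using f mem by (auto simp: T_def F_def fun_eq_iff induced_rep_def)
        moreover have "F \<in> rspace ?P" by (simp add: permutation_rep_def F_def)
        ultimately show "f \<in> T ` rspace ?P" by blast
      qed
    qed
    show "linear_map_on (rscale ?P) (rscale ?N) (rspace ?P) T"
      by (auto simp: linear_map_on_def T_def permutation_rep_def induced_rep_def trivial_rep_def fun_eq_iff)
    show "T (ract ?P g v) = ract ?N g (T v)" if "g \<in> carrier G" for g v
      using that mem K.subset
      by (auto simp: T_def permutation_rep_def induced_rep_def fun_eq_iff lcos_m_assoc)
  qed
qed

section \<open>Polynomials and monomials\<close>

lemma lookup_cscale [simp]: "Poly_Mapping.lookup (cscale c p) m = c * Poly_Mapping.lookup p m"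
  by (simp add: cscale_def mult_map_scale_conv_mult[symmetric] Poly_Mapping.map.rep_eq when_def)

lemma vector_space_cscale: "vector_space cscale"
  by standard (rule poly_mapping_eqI, simp add: lookup_add algebra_simps)+

lemma cscale_single [simp]: "cscale c (Poly_Mapping.single m d) = Poly_Mapping.single m (c * d)"
  by (simp add: cscale_def mult_single)

lemma keys_subset_iff: "Poly_Mapping.keys p \<subseteq> A \<longleftrightarrow> (\<forall>m. m \<notin> A \<longrightarrow> Poly_Mapping.lookup p m = 0)"
  by (auto simp: in_keys_iff)

lemma monomial_eq_iff: "Poly_Mapping.single m (1::complex) = Poly_Mapping.single m' 1 \<longleftrightarrow> m = m'"
  by (metis lookup_single_eq lookup_single_not_eq zero_neq_one)

lemma poly_eq_sum_monomials:
  assumes "finite A" "Poly_Mapping.keys p \<subseteq> A"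
  shows "p = (\<Sum>m\<in>A. cscale (Poly_Mapping.lookup p m) (Poly_Mapping.single m 1))"
proof (rule poly_mapping_eqI)
  fix m
  show "Poly_Mapping.lookup p m =
      Poly_Mapping.lookup (\<Sum>m\<in>A. cscale (Poly_Mapping.lookup p m) (Poly_Mapping.single m 1)) m"
    using assms by (auto simp: lookup_sum lookup_single when_def sum.delta in_keys_iff)
qed

text \<open>Replaces the span by a condition on supports, so that membership is checked coefficient
  by coefficient.\<close>

lemma span_monomials:
  "Modules.module.span cscale ((\<lambda>m. Poly_Mapping.single m 1) ` A) = {p. Poly_Mapping.keys p \<subseteq> A}"
  (is "Modules.module.span cscale ?M = ?P")
proof -
  interpret vector_space cscale by (rule vector_space_cscale)
  show ?thesis
  proof
    have "subspace ?P"
      by (simp add: subspace_def keys_subset_iff lookup_add)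
    then show "span ?M \<subseteq> ?P" by (intro span_minimal) auto
    show "?P \<subseteq> span ?M"
    proof
      fix p assume "p \<in> ?P"
      then have "(\<Sum>m\<in>Poly_Mapping.keys p. cscale (Poly_Mapping.lookup p m) (Poly_Mapping.single m 1)) \<in> span ?M"
        by (intro span_sum span_scale span_base) auto
      then show "p \<in> span ?M" using poly_eq_sum_monomials[OF finite_keys subset_refl, of p] by simp
    qed
  qed
qed

text \<open>Independence is visible from supports: the support of the monomial m is not contained in
  \<open>A - {m}\<close>.\<close>

lemma dim_span_monomials:
  "vector_space.dim cscale (Modules.module.span cscale ((\<lambda>m. Poly_Mapping.single m 1) ` A)) = card A"
proof -
  interpret vector_space cscale by (rule vector_space_cscale)
  let ?x = "\<lambda>m. Poly_Mapping.single m (1::complex)"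
  have inj: "inj_on ?x A" by (auto simp: inj_on_def monomial_eq_iff)
  have "?x m \<notin> span (?x ` (A - {m}))" for m by (simp add: span_monomials)
  moreover have "?x ` A - {?x m} = ?x ` (A - {m})" if "m \<in> A" for m
    using that by (auto simp: monomial_eq_iff)
  ultimately have "independent (?x ` A)" by (auto simp: dependent_def)
  then show ?thesis by (simp add: dim_eq_card_independent card_image[OF inj])
qed

lemma single_power:
  "Poly_Mapping.single (Poly_Mapping.single j 1) c ^ e = Poly_Mapping.single (Poly_Mapping.single j e) (c ^ e :: complex)"
  for j :: nat
proof (induction e)
  case (Suc e)
  then show ?case by (simp add: mult_single single_add[symmetric])
qed (simp add: single_one)

lemma prod_single:
  "(\<Prod>i\<in>A. Poly_Mapping.single (a i) (b i)) = Poly_Mapping.single (\<Sum>i\<in>A. a i) (\<Prod>i\<in>A. b i :: complex)"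
  for a :: "'i \<Rightarrow> nat \<Rightarrow>\<^sub>0 nat"
  by (induction A rule: infinite_finite_induct) (simp_all add: mult_single single_one)

section \<open>Evaluation of monomials and the action on coefficients\<close>

text \<open>On points of Gamma^n this is the character with exponent vector m.\<close>

definition monom_eval :: "nat \<Rightarrow> (nat \<Rightarrow>\<^sub>0 nat) \<Rightarrow> (nat \<Rightarrow> complex) \<Rightarrow> complex" where
  "monom_eval n m x = (\<Prod>i\<in>{1..n}. x i ^ Poly_Mapping.lookup m i)"

lemma monom_eval_cong: "(\<And>i. i \<in> {1..n} \<Longrightarrow> x i = y i) \<Longrightarrow> monom_eval n m x = monom_eval n m y"
  by (simp add: monom_eval_def)

lemma monom_eval_mult: "monom_eval n m (\<lambda>i. x i * y i) = monom_eval n m x * monom_eval n m y"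
  by (simp add: monom_eval_def power_mult_distrib prod.distrib)

lemma monom_eval_inverse: "monom_eval n m (\<lambda>i. inverse (x i)) = inverse (monom_eval n m x)"
  by (simp add: monom_eval_def power_inverse prod_inversef[symmetric])

lemma monom_eval_map_key:
  assumes "\<sigma> permutes {1..n}"
  shows "monom_eval n (Poly_Mapping.map_key \<sigma> m) (\<lambda>i. x (\<sigma> i)) = monom_eval n m x"
proof -
  have "monom_eval n (Poly_Mapping.map_key \<sigma> m) (\<lambda>i. x (\<sigma> i)) =
      (\<Prod>i\<in>{1..n}. x (\<sigma> i) ^ Poly_Mapping.lookup m (\<sigma> i))"
    by (simp add: monom_eval_def map_key.rep_eq permutes_inj[OF assms])
  also have "\<dots> = monom_eval n m x"
    unfolding monom_eval_def using permutes_imp_bij[OF assms] by (rule prod.reindex_bij_betw)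
  finally show ?thesis .
qed

text \<open>The substitution turns x^q into the monomial with exponent \<open>?e q\<close>, that is
  q o sigma^-1, with factor \<open>?c q\<close>. Hence at most one q contributes at m, namely m o
  sigma. The bound on the keys matches \<open>?c q\<close> with \<open>monom_eval\<close>, which
  multiplies over 1 to n.\<close>

lemma lookup_ract_CM:
  assumes \<sigma>: "\<sigma> permutes {1..n}"
    and p: "\<And>m. m \<in> Poly_Mapping.keys p \<Longrightarrow> Poly_Mapping.keys m \<subseteq> {1..n}"
  shows "Poly_Mapping.lookup (ract (CM n k) (g, \<sigma>) p) m =
    inverse (monom_eval n m g) * Poly_Mapping.lookup p (Poly_Mapping.map_key \<sigma> m)"
proof -
  let ?e = "\<lambda>q. \<Sum>i\<in>Poly_Mapping.keys q. Poly_Mapping.single (\<sigma> i) (Poly_Mapping.lookup q i)"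
  let ?c = "\<lambda>q. \<Prod>i\<in>Poly_Mapping.keys q. inverse (g (\<sigma> i)) ^ Poly_Mapping.lookup q i"
  note inj = permutes_inj[OF \<sigma>]
  have e: "?e q = m \<longleftrightarrow> Poly_Mapping.map_key \<sigma> m = q" for q
  proof -
    have l: "Poly_Mapping.lookup (?e q) (\<sigma> j) = Poly_Mapping.lookup q j" for j
      using inj by (auto simp: lookup_sum lookup_single when_def inj_eq sum.delta in_keys_iff)
    show ?thesis
    proof
      assume "?e q = m"
      then show "Poly_Mapping.map_key \<sigma> m = q"
        using l by (auto intro!: poly_mapping_eqI simp: map_key.rep_eq[OF inj])
    next
      assume q: "Poly_Mapping.map_key \<sigma> m = q"
      show "?e q = m"
      proof (rule poly_mapping_eqI)
        fix i
        obtain j where "i = \<sigma> j" using permutes_surj[OF \<sigma>] by (metis surjD)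
        then show "Poly_Mapping.lookup (?e q) i = Poly_Mapping.lookup m i"
          using l[of j] by (simp add: q[symmetric] map_key.rep_eq[OF inj])
      qed
    qed
  qed
  have c: "?c q = inverse (monom_eval n m g)"
    if "q \<in> Poly_Mapping.keys p" "Poly_Mapping.map_key \<sigma> m = q" for q
  proof -
    have "?c q = (\<Prod>i\<in>{1..n}. inverse (g (\<sigma> i)) ^ Poly_Mapping.lookup q i)"
      using p[OF that(1)] by (intro prod.mono_neutral_left) (auto simp: in_keys_iff)
    also have "\<dots> = monom_eval n m (\<lambda>i. inverse (g i))"
      using monom_eval_map_key[OF \<sigma>, of m "\<lambda>i. inverse (g i)"] that(2) by (simp add: monom_eval_def)
    finally show ?thesis by (simp add: monom_eval_inverse)
  qed
  have "ract (CM n k) (g, \<sigma>) p = (\<Sum>q\<in>Poly_Mapping.keys p.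
      cscale (Poly_Mapping.lookup p q) (Poly_Mapping.single (?e q) (?c q)))"
    by (simp add: CM_def poly_subst_def var_def single_power prod_single del: One_nat_def)
  then have "Poly_Mapping.lookup (ract (CM n k) (g, \<sigma>) p) m =
      (\<Sum>q\<in>Poly_Mapping.keys p. if Poly_Mapping.map_key \<sigma> m = q
         then inverse (monom_eval n m g) * Poly_Mapping.lookup p q else 0)"
    by (auto simp: lookup_sum lookup_single when_def e c intro!: sum.cong)
  then show ?thesis by (auto simp: in_keys_iff)
qed

section \<open>Exponent vectors\<close>

text \<open>The S_n-orbit of the sequence lambda, given through its multiset of values: invariance
  under permutations is then immediate, and k is recovered by counting.\<close>

definition exponents :: "nat \<Rightarrow> nat list \<Rightarrow> (nat \<Rightarrow>\<^sub>0 nat) set" where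
  "exponents n k = {m. Poly_Mapping.keys m \<subseteq> {1..n} \<and>
     image_mset (Poly_Mapping.lookup m) (mset_set {1..n}) = mset (lam k)}"

lemma count_lam: "count (mset (lam k)) j = (if j < length k then k ! j else 0)"
proof -
  have "count (mset (concat (map (\<lambda>i. replicate (k ! i) i) [0..<N]))) j = (if j < N then k ! j else 0)" for N
    by (induction N) (auto simp: less_Suc_eq)
  then show ?thesis by (simp add: lam_def)
qed

lemma length_lam: "length (lam k) = sum_list k"
proof -
  have "length (lam k) = sum_list (map ((!) k) [0..<length k])"
    by (simp add: lam_def length_concat o_def)
  then show ?thesis by (simp add: map_nth)
qed

lemma sum_list_lam: "sum_list (lam k) = (\<Sum>i<length k. i * k ! i)"
proof -
  have "sum_list (concat (map (\<lambda>i. replicate (k ! i) i) [0..<N])) = (\<Sum>i<N. i * k ! i)" for N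
    by (induction N) (auto simp: sum_list_replicate)
  then show ?thesis by (simp add: lam_def)
qed

lemma image_mset_nth_lam:
  assumes "sum_list k = n"
  shows "image_mset (\<lambda>j. lam k ! (j - 1)) (mset_set {1..n}) = mset (lam k)"
proof -
  have "mset_set {1..n} = image_mset Suc (mset_set {0..<n})"
    by (simp add: image_mset_mset_set image_Suc_atLeastLessThan atLeastLessThanSuc_atLeastAtMost)
  then have "image_mset (\<lambda>j. lam k ! (j - 1)) (mset_set {1..n}) = image_mset ((!) (lam k)) (mset_set {0..<n})"
    by (simp add: image_mset.compositionality o_def)
  also have "\<dots> = mset (map ((!) (lam k)) [0..<length (lam k)])"
    by (simp add: assms length_lam)
  finally show ?thesis by (simp only: map_nth)
qed

lemma image_mset_permutes:
  assumes "\<sigma> permutes A"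
  shows "image_mset (\<lambda>i. f (\<sigma> i)) (mset_set A) = image_mset f (mset_set A)"
proof -
  have "image_mset (\<lambda>i. f (\<sigma> i)) (mset_set A) = image_mset f (image_mset \<sigma> (mset_set A))"
    by (simp add: image_mset.compositionality o_def)
  also have "image_mset \<sigma> (mset_set A) = mset_set A"
    using permutes_inj_on[OF assms] permutes_image[OF assms] by (simp add: image_mset_mset_set)
  finally show ?thesis .
qed

lemma lookup_sum_single_permutes:
  fixes \<sigma> :: "nat \<Rightarrow> nat" and a :: "nat \<Rightarrow> nat"
  assumes "\<sigma> permutes {1..n}"
  shows "Poly_Mapping.lookup (\<Sum>j\<in>{1..n}. Poly_Mapping.single (\<sigma> j) (a j)) (\<sigma> i) =
    (if i \<in> {1..n} then a i else 0)"
  using permutes_inj[OF assms] by (auto simp: lookup_sum lookup_single when_def inj_eq)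

text \<open>The right side is how \<open>Mon\<close> forms its exponents. Conversely, equal
  multisets of values give a permutation \<open>\<tau>\<close> such that m at i is lambda at
  \<open>\<tau> i\<close>; since \<open>Mon\<close> moves the variables, the witness is the inverse
  of \<open>\<tau>\<close>.\<close>

lemma exponents_eq_sum_single:
  assumes "sum_list k = n"
  shows "exponents n k =
    {\<Sum>j\<in>{1..n}. Poly_Mapping.single (\<sigma> j) (lam k ! (j - 1)) | \<sigma>. \<sigma> permutes {1..n}}" (is "_ = ?R")
proof (rule Set.set_eqI, rule iffI)
  fix m assume "m \<in> ?R"
  then obtain \<sigma> where \<sigma>: "\<sigma> permutes {1..n}"
    and m: "m = (\<Sum>j\<in>{1..n}. Poly_Mapping.single (\<sigma> j) (lam k ! (j - 1)))" by blast
  have l: "Poly_Mapping.lookup m (\<sigma> i) = (if i \<in> {1..n} then lam k ! (i - 1) else 0)" for i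
    unfolding m by (rule lookup_sum_single_permutes[OF \<sigma>])
  have "Poly_Mapping.keys m \<subseteq> {1..n}"
  proof
    fix i assume "i \<in> Poly_Mapping.keys m"
    then have "inv' \<sigma> i \<in> {1..n}"
      using l[of "inv' \<sigma> i"] \<sigma> by (auto simp: in_keys_iff permutes_inverses split: if_splits)
    then show "i \<in> {1..n}" using permutes_in_image[OF permutes_inv[OF \<sigma>]] by blast
  qed
  moreover have "image_mset (Poly_Mapping.lookup m) (mset_set {1..n}) = mset (lam k)"
    unfolding image_mset_nth_lam[OF assms, symmetric]
    by (subst image_mset_permutes[OF \<sigma>, symmetric], rule image_mset_cong) (simp add: l)
  ultimately show "m \<in> exponents n k" by (simp add: exponents_def)
next
  fix m assume "m \<in> exponents n k"
  then have keys: "Poly_Mapping.keys m \<subseteq> {1..n}" and eq: "image_mset (Poly_Mapping.lookup m) (mset_set {1..n}) =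
      image_mset (\<lambda>j. lam k ! (j - 1)) (mset_set {1..n})"
    unfolding image_mset_nth_lam[OF assms] by (auto simp: exponents_def)
  obtain \<tau> where \<tau>: "\<tau> permutes {1..n}" "\<forall>i\<in>{1..n}. Poly_Mapping.lookup m i = lam k ! (\<tau> i - 1)"
    by (rule image_mset_eq_implies_permutes[OF finite_atLeastAtMost eq])
  have "m = (\<Sum>j\<in>{1..n}. Poly_Mapping.single (inv' \<tau> j) (lam k ! (j - 1)))"
  proof (rule poly_mapping_eqI)
    fix i
    show "Poly_Mapping.lookup m i =
        Poly_Mapping.lookup (\<Sum>j\<in>{1..n}. Poly_Mapping.single (inv' \<tau> j) (lam k ! (j - 1))) i"
      using lookup_sum_single_permutes[OF permutes_inv[OF \<tau>(1)], where a = "\<lambda>j. lam k ! (j - 1)" and i = "\<tau> i"]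
        \<tau>(2) keys permutes_in_image[OF \<tau>(1), of i]
      by (cases "i \<in> {1..n}")
        (auto simp: permutes_inverses[OF \<tau>(1)] keys_subset_iff simp del: One_nat_def atLeastAtMost_iff)
  qed
  then show "m \<in> ?R" using permutes_inv[OF \<tau>(1)] by blast
qed

lemma Mon_eq:
  assumes "sum_list k = n"
  shows "Mon n k = (\<lambda>m. Poly_Mapping.single m 1) ` exponents n k"
  unfolding Mon_def exponents_eq_sum_single[OF assms]
  by (auto simp: var_def single_power prod_single simp del: One_nat_def)

lemma exponents_nonempty: "sum_list k = n \<Longrightarrow> exponents n k \<noteq> {}"
  unfolding exponents_eq_sum_single using permutes_id by blast

lemma map_key_mem_exponents:
  assumes \<sigma>: "\<sigma> permutes {1..n}"
  shows "Poly_Mapping.map_key \<sigma> m \<in> exponents n k \<longleftrightarrow> m \<in> exponents n k"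
proof -
  have "image_mset (Poly_Mapping.lookup (Poly_Mapping.map_key \<sigma> m)) (mset_set {1..n}) =
      image_mset (Poly_Mapping.lookup m) (mset_set {1..n})"
    using image_mset_permutes[OF \<sigma>, of "Poly_Mapping.lookup m"]
    by (simp add: map_key.rep_eq[OF permutes_inj[OF \<sigma>]] o_def)
  moreover have "Poly_Mapping.keys (Poly_Mapping.map_key \<sigma> m) \<subseteq> {1..n} \<longleftrightarrow> Poly_Mapping.keys m \<subseteq> {1..n}"
    unfolding keys_map_key[OF permutes_inj[OF \<sigma>]] vimage_subset_eq[OF permutes_bij[OF \<sigma>]] permutes_image[OF \<sigma>] ..
  ultimately show ?thesis by (simp add: exponents_def)
qed

text \<open>Two functions on 1 to n with the same multiset of values differ by a permutation. This
  is the transitivity of S_n on the monomial basis.\<close>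

lemma exponents_transitive:
  assumes "m \<in> exponents n k" "m' \<in> exponents n k"
  obtains \<sigma> where "\<sigma> permutes {1..n}" "Poly_Mapping.map_key \<sigma> m' = m"
proof -
  have eq: "image_mset (Poly_Mapping.lookup m) (mset_set {1..n}) = image_mset (Poly_Mapping.lookup m') (mset_set {1..n})"
    and keys: "Poly_Mapping.keys m \<subseteq> {1..n}" "Poly_Mapping.keys m' \<subseteq> {1..n}"
    using assms by (simp_all add: exponents_def)
  obtain \<sigma> where \<sigma>: "\<sigma> permutes {1..n}" "\<forall>i\<in>{1..n}. Poly_Mapping.lookup m i = Poly_Mapping.lookup m' (\<sigma> i)"
    by (rule image_mset_eq_implies_permutes[OF finite_atLeastAtMost eq])
  have "Poly_Mapping.map_key \<sigma> m' = m"
  proof (rule poly_mapping_eqI)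
    fix i
    show "Poly_Mapping.lookup (Poly_Mapping.map_key \<sigma> m') i = Poly_Mapping.lookup m i"
      using \<sigma>(2) keys permutes_in_image[OF \<sigma>(1), of i]
      by (cases "i \<in> {1..n}") (auto simp: map_key.rep_eq[OF permutes_inj[OF \<sigma>(1)]] keys_subset_iff
          simp del: One_nat_def atLeastAtMost_iff)
  qed
  then show thesis using that \<sigma>(1) by blast
qed

text \<open>The common degree of all monomials of the module; it is the exponent that governs the
  action of the diagonal.\<close>

lemma sum_exponents:
  assumes "m \<in> exponents n k"
  shows "(\<Sum>i\<in>{1..n}. Poly_Mapping.lookup m i) = (\<Sum>i<length k. i * k ! i)"
proof -
  have "(\<Sum>i\<in>{1..n}. Poly_Mapping.lookup m i) = sum_mset (mset (lam k))"
    using assms by (simp add: exponents_def sum_unfold_sum_mset)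
  then show ?thesis by (simp add: sum_mset_sum_list sum_list_lam)
qed

text \<open>\<open>k ! i\<close> counts the exponents equal to i. Trailing zeros of k leave no trace
  in \<open>lam k\<close>, hence the assumption of equal length.\<close>

lemma exponents_unique:
  assumes "m \<in> exponents n k" "m \<in> exponents n k'" "length k = length k'"
  shows "k = k'"
proof (rule nth_equalityI)
  fix i assume "i < length k"
  moreover have "mset (lam k) = mset (lam k')" using assms by (simp add: exponents_def)
  ultimately show "k ! i = k' ! i" using count_lam[of k i] count_lam[of k' i] assms(3) by simp
qed fact

section \<open>Exponent vectors as an index set for the characters, and their number\<close>

definition exponent_box :: "nat \<Rightarrow> nat \<Rightarrow> (nat \<Rightarrow>\<^sub>0 nat) set" where
  "exponent_box r n = {m. Poly_Mapping.keys m \<subseteq> {1..n} \<and> (\<forall>i\<in>{1..n}. Poly_Mapping.lookup m i < r)}"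

lemma exponents_subset_box: "exponents n k \<subseteq> exponent_box (length k) n"
proof
  fix m assume m: "m \<in> exponents n k"
  have "Poly_Mapping.lookup m i < length k" if "i \<in> {1..n}" for i
  proof -
    have "mset (lam k) = image_mset (Poly_Mapping.lookup m) (mset_set {1..n})"
      using m by (simp add: exponents_def)
    then have "count (mset (lam k)) (Poly_Mapping.lookup m i) > 0"
      using that by (simp only: count_greater_zero_iff) simp
    then show ?thesis by (simp add: count_lam split: if_splits)
  qed
  then show "m \<in> exponent_box (length k) n" using m by (simp add: exponent_box_def exponents_def)
qed

text \<open>A vector belongs to the k recording how often each value below r occurs in it. This is
  what lets a Fourier sum be split among the modules.\<close>

lemma exponent_box_eq: "exponent_box r n = (\<Union>k\<in>compositions r n. exponents n k)"
proof
  show "(\<Union>k\<in>compositions r n. exponents n k) \<subseteq> exponent_box r n"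
    using exponents_subset_box by (auto simp: compositions_def)
  show "exponent_box r n \<subseteq> (\<Union>k\<in>compositions r n. exponents n k)"
  proof
    fix m assume m: "m \<in> exponent_box r n"
    define M where "M = image_mset (Poly_Mapping.lookup m) (mset_set {1..n})"
    define k where "k = map (count M) [0..<r]"
    have M: "set_mset M \<subseteq> {..<r}" using m by (auto simp: M_def exponent_box_def)
    have "sum_list k = (\<Sum>i<r. count M i)"
      by (simp add: k_def interv_sum_list_conv_sum_set_nat atLeast0LessThan)
    also have "\<dots> = size M"
      unfolding size_multiset_overloaded_eq using M
      by (intro sum.mono_neutral_right) (auto simp: not_in_iff)
    also have "\<dots> = n" by (simp add: M_def)
    finally have "k \<in> compositions r n" by (simp add: compositions_def k_def)
    moreover have "mset (lam k) = M"
      using M by (intro multiset_eqI) (auto simp: count_lam k_def not_in_iff[symmetric])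
    then have "m \<in> exponents n k" using m by (simp add: exponents_def exponent_box_def M_def)
    ultimately show "m \<in> (\<Union>k\<in>compositions r n. exponents n k)" by blast
  qed
qed

lemma exponent_box_eqI:
  assumes "m \<in> exponent_box r n" "m' \<in> exponent_box r n"
    and "\<And>i. i \<in> {1..n} \<Longrightarrow> Poly_Mapping.lookup m i = Poly_Mapping.lookup m' i"
  shows "m = m'"
proof (rule poly_mapping_eqI)
  fix i show "Poly_Mapping.lookup m i = Poly_Mapping.lookup m' i"
    using assms by (cases "i \<in> {1..n}") (simp_all add: exponent_box_def keys_subset_iff)
qed

text \<open>Turns sums over exponent vectors into sums over a product of ranges, which factor
  variable by variable.\<close>

lemma bij_betw_exponent_box:
  "bij_betw (\<lambda>m. \<lambda>i\<in>{1..n}. Poly_Mapping.lookup m i) (exponent_box r n) (\<Pi>\<^sub>E i\<in>{1..n}. {..<r})"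
  unfolding bij_betw_def
proof
  show "inj_on (\<lambda>m. \<lambda>i\<in>{1..n}. Poly_Mapping.lookup m i) (exponent_box r n)"
    by (rule inj_onI) (metis exponent_box_eqI restrict_apply')
  show "(\<lambda>m. \<lambda>i\<in>{1..n}. Poly_Mapping.lookup m i) ` exponent_box r n = (\<Pi>\<^sub>E i\<in>{1..n}. {..<r})"
  proof
    show "(\<Pi>\<^sub>E i\<in>{1..n}. {..<r}) \<subseteq> (\<lambda>m. \<lambda>i\<in>{1..n}. Poly_Mapping.lookup m i) ` exponent_box r n"
    proof
      fix f assume f: "f \<in> (\<Pi>\<^sub>E i\<in>{1..n}. {..<r})"
      define m where "m = (\<Sum>j\<in>{1..n}. Poly_Mapping.single j (f j))"
      have m: "Poly_Mapping.lookup m i = (if i \<in> {1..n} then f i else 0)" for i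
        using lookup_sum_single_permutes[OF permutes_id, where a = f and i = i and n = n] by (simp add: m_def)
      have "m \<in> exponent_box r n"
        using f by (auto simp: exponent_box_def keys_subset_iff m)
      moreover have "f = (\<lambda>i\<in>{1..n}. Poly_Mapping.lookup m i)"
        using f by (auto simp: fun_eq_iff m PiE_iff extensional_def)
      ultimately show "f \<in> (\<lambda>m. \<lambda>i\<in>{1..n}. Poly_Mapping.lookup m i) ` exponent_box r n" by blast
    qed
  qed (auto simp: exponent_box_def)
qed

lemma finite_exponent_box: "finite (exponent_box r n)"
  using bij_betw_finite[OF bij_betw_exponent_box, of r n] by (simp add: finite_PiE)

lemma finite_exponents: "finite (exponents n k)"
  using finite_subset[OF exponents_subset_box finite_exponent_box] .

lemma finite_compositions: "finite (compositions r n)"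
proof (rule finite_subset)
  show "compositions r n \<subseteq> {k. set k \<subseteq> {..n} \<and> length k = r}"
    by (auto simp: compositions_def intro: member_le_sum_list)
qed (rule finite_lists_length_eq, simp)

text \<open>Reading the vectors as words identifies them with the arrangements of the multiset of
  \<open>lam k\<close>. The product form avoids division of naturals.\<close>

lemma card_exponents:
  assumes "sum_list k = n"
  shows "card (exponents n k) * (\<Prod>i<length k. fact (k ! i)) = fact n"
proof -
  let ?f = "\<lambda>m. map (Poly_Mapping.lookup m) [1..<Suc n]"
  have mset_f: "mset (?f m) = image_mset (Poly_Mapping.lookup m) (mset_set {1..n})" for m
    by (simp add: atLeastLessThanSuc_atLeastAtMost del: upt_Suc)
  have "bij_betw ?f (exponents n k) (permutations_of_multiset (mset (lam k)))"
    unfolding bij_betw_def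
  proof
    show "inj_on ?f (exponents n k)"
    proof (rule inj_onI)
      fix m m' assume m: "m \<in> exponents n k" "m' \<in> exponents n k" "?f m = ?f m'"
      show "m = m'"
        by (rule exponent_box_eqI[of _ "length k" n])
          (use m exponents_subset_box in \<open>auto simp del: upt_Suc\<close>)
    qed
    show "?f ` exponents n k = permutations_of_multiset (mset (lam k))"
    proof
      show "?f ` exponents n k \<subseteq> permutations_of_multiset (mset (lam k))"
        by (auto simp: permutations_of_multiset_def exponents_def mset_f simp del: upt_Suc mset_map One_nat_def)
      show "permutations_of_multiset (mset (lam k)) \<subseteq> ?f ` exponents n k"
      proof
        fix xs assume xs: "xs \<in> permutations_of_multiset (mset (lam k))"
        then have mset: "mset xs = mset (lam k)" by (simp add: permutations_of_multiset_def)
        then have len: "length xs = n" using mset_eq_length[OF mset] by (simp add: length_lam assms)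
        define m where "m = (\<Sum>j\<in>{1..n}. Poly_Mapping.single j (xs ! (j - 1)))"
        have m: "Poly_Mapping.lookup m i = (if i \<in> {1..n} then xs ! (i - 1) else 0)" for i
          using lookup_sum_single_permutes[OF permutes_id, where a = "\<lambda>j. xs ! (j - 1)" and i = i and n = n] by (simp add: m_def)
        have xs_eq: "xs = ?f m" by (rule nth_equalityI) (auto simp: len m simp del: upt_Suc)
        moreover have "Poly_Mapping.keys m \<subseteq> {1..n}" by (simp add: keys_subset_iff m)
        then have "m \<in> exponents n k"
          by (simp only: exponents_def mset_f[symmetric] xs_eq[symmetric] mset mem_Collect_eq simp_thms)
        ultimately show "xs \<in> ?f ` exponents n k" by blast
      qed
    qed
  qed
  then have "card (exponents n k) = card (permutations_of_multiset (mset (lam k)))"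
    by (rule bij_betw_same_card)
  \<comment> \<open>The count of arrangements runs only over values that occur; the others have
    \<open>k ! i = 0\<close> and contribute the factor \<open>fact 0 = 1\<close>.\<close>
  moreover have "(\<Prod>i<length k. fact (k ! i)) = (\<Prod>i\<in>set_mset (mset (lam k)). fact (count (mset (lam k)) i) :: nat)"
  proof (rule prod.mono_neutral_cong_right)
    show "set_mset (mset (lam k)) \<subseteq> {..<length k}"
      using count_lam[of k] by (metis count_greater_zero_iff lessThan_iff less_numeral_extra(3) subsetI)
    show "\<forall>i\<in>{..<length k} - set_mset (mset (lam k)). fact (k ! i) = 1"
      using count_lam[of k] by (metis DiffE fact_0 lessThan_iff not_in_iff)
    show "fact (k ! i) = fact (count (mset (lam k)) i)" if "i \<in> set_mset (mset (lam k))" for i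
      using that count_lam[of k i] by (metis count_greater_zero_iff less_numeral_extra(3))
  qed simp
  ultimately show ?thesis
    using card_permutations_of_multiset_aux[of "mset (lam k)"] by (simp add: length_lam assms)
qed

section \<open>Characters of \<open>\<Gamma>\<^sup>n\<close> and the modules \<open>\<complex>M(\<^bold>k)\<close>\<close>

lemma xi_power: "xi r ^ j = cis (2 * pi * real j / real r)"
  by (simp add: xi_def cis_conv_exp exp_of_nat_mult[symmetric] mult_ac)

lemma carrier_Gam: "r \<ge> 1 \<Longrightarrow> carrier (Gam r) = {z. z ^ r = 1}"
  using bij_betw_roots_unity[of r] by (auto simp: Gam_def bij_betw_def xi_power)

lemma finite_Gam: "finite (carrier (Gam r))"
  by (simp add: Gam_def)

lemma card_Gam: "r \<ge> 1 \<Longrightarrow> card (carrier (Gam r)) = r"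
  by (simp add: carrier_Gam card_roots_unity_eq)

lemma inj_on_xi_power: "r \<ge> 1 \<Longrightarrow> inj_on (\<lambda>j. xi r ^ j) {..<r}"
  using bij_betw_roots_unity[of r] by (simp add: bij_betw_def xi_power)

lemma xi_power_eq_1_iff:
  assumes "r \<ge> 1"
  shows "xi r ^ j = 1 \<longleftrightarrow> r dvd j"
proof
  have "xi r ^ j = xi r ^ (r * (j div r) + j mod r)" by simp
  also have "\<dots> = xi r ^ (j mod r)"
    by (simp only: power_add power_mult xi_pow_r[OF assms]) simp
  finally have red: "xi r ^ j = xi r ^ (j mod r)" .
  assume "xi r ^ j = 1"
  then have "xi r ^ (j mod r) = xi r ^ 0" using red by simp
  then have "j mod r = 0" using inj_onD[OF inj_on_xi_power[OF assms], of "j mod r" 0] assms by simp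
  then show "r dvd j" by auto
next
  assume "r dvd j"
  then show "xi r ^ j = 1" by (elim dvdE) (simp add: power_mult xi_pow_r[OF assms])
qed

lemma Gam_nonzero: "r \<ge> 1 \<Longrightarrow> x \<in> carrier (Gam r) \<Longrightarrow> x \<noteq> 0"
  by (auto simp: carrier_Gam power_0_left)

lemma xi_mem_Gam: "r \<ge> 1 \<Longrightarrow> xi r \<in> carrier (Gam r)"
  by (simp add: carrier_Gam xi_pow_r)

text \<open>Replacing x by xi x multiplies the sum by xi^(a-b), which differs from 1 for distinct a,
  b below r, so the sum vanishes. Inverses stand for conjugates on the unit circle.\<close>

lemma sum_Gam_power:
  assumes r: "r \<ge> 1" and ab: "a < r" "b < r"
  shows "(\<Sum>x\<in>carrier (Gam r). x ^ a * inverse (x ^ b)) = (if a = b then of_nat r else 0)"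
proof (cases "a = b")
  case True
  have "(\<Sum>x\<in>carrier (Gam r). x ^ a * inverse (x ^ b)) = (\<Sum>x\<in>carrier (Gam r). 1)"
    by (rule sum.cong) (auto simp: True dest: Gam_nonzero[OF r])
  then show ?thesis using True by (simp add: card_Gam[OF r])
next
  case False
  let ?S = "\<Sum>x\<in>carrier (Gam r). x ^ a * inverse (x ^ b)"
  let ?w = "xi r ^ a * inverse (xi r ^ b)"
  have nz: "xi r \<noteq> 0" by (simp add: xi_def)
  have "bij_betw ((*) (xi r)) (carrier (Gam r)) (carrier (Gam r))"
    by (rule bij_betwI[where g = "\<lambda>x. x / xi r"])
      (use nz in \<open>auto simp: carrier_Gam[OF r] power_mult_distrib power_divide xi_pow_r[OF r]\<close>)
  then have "?S = (\<Sum>x\<in>carrier (Gam r). (xi r * x) ^ a * inverse ((xi r * x) ^ b))"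
    by (rule sum.reindex_bij_betw[symmetric])
  also have "\<dots> = ?w * ?S"
    by (simp add: sum_distrib_left power_mult_distrib mult_ac)
  finally have "(?w - 1) * ?S = 0" by (simp add: algebra_simps)
  moreover have "?w \<noteq> 1"
  proof
    assume "?w = 1"
    then have "xi r ^ a = xi r ^ b" using nz by (simp add: field_simps)
    then show False using inj_onD[OF inj_on_xi_power[OF r], of a b] ab False by simp
  qed
  ultimately show ?thesis using False by simp
qed

text \<open>The dual relation: for distinct x and y this is a geometric sum in x/y, an r-th root of
  unity other than 1.\<close>

lemma sum_power_Gam:
  assumes r: "r \<ge> 1" and xy: "x \<in> carrier (Gam r)" "y \<in> carrier (Gam r)"
  shows "(\<Sum>a<r. x ^ a * inverse (y ^ a)) = (if x = y then of_nat r else 0)"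
proof -
  have y: "y \<noteq> 0" using Gam_nonzero[OF r xy(2)] .
  have "(\<Sum>a<r. x ^ a * inverse (y ^ a)) = (\<Sum>a<r. (x / y) ^ a)"
    by (simp add: divide_inverse power_mult_distrib power_inverse)
  also have "\<dots> = (if x = y then of_nat r else 0)"
  proof (cases "x = y")
    case False
    then have "x / y \<noteq> 1" using y by simp
    moreover have "(x / y) ^ r = 1" using xy by (simp add: carrier_Gam[OF r] power_divide)
    ultimately show ?thesis using False by (simp add: geometric_sum)
  qed (use y in simp)
  finally show ?thesis .
qed

lemma carrier_Gam_pow: "carrier (Gam_pow r n) = (\<Pi>\<^sub>E i\<in>{1..n}. carrier (Gam r))"
  by (simp add: Gam_pow_def)

lemma finite_Gam_pow: "finite (carrier (Gam_pow r n))"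
  unfolding carrier_Gam_pow by (intro finite_PiE finite_Gam) simp

lemma Gam_pow_mult: "i \<in> {1..n} \<Longrightarrow> (g \<otimes>\<^bsub>Gam_pow r n\<^esub> h) i = g i * h i"
  by (simp add: Gam_pow_def Gam_def)

lemma prod_if_eq_power:
  assumes "finite A"
  shows "(\<Prod>i\<in>A. if P i then c else 0) = (if \<forall>i\<in>A. P i then c ^ card A else (0::complex))"
  using assms by (induction A rule: finite_induct) auto

text \<open>Orthogonality of characters: the sum over Gamma^n factors into one sum per
  coordinate.\<close>

lemma monom_eval_orthogonal:
  assumes r: "r \<ge> 1" and m: "m \<in> exponent_box r n" "m' \<in> exponent_box r n"
  shows "(\<Sum>g\<in>carrier (Gam_pow r n). monom_eval n m g * inverse (monom_eval n m' g)) =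
    (if m = m' then of_nat r ^ n else 0)"
proof -
  let ?l = "Poly_Mapping.lookup"
  have "(\<Sum>g\<in>carrier (Gam_pow r n). monom_eval n m g * inverse (monom_eval n m' g)) =
      (\<Sum>g\<in>(\<Pi>\<^sub>E i\<in>{1..n}. carrier (Gam r)). \<Prod>i\<in>{1..n}. g i ^ ?l m i * inverse (g i ^ ?l m' i))"
    by (simp add: carrier_Gam_pow monom_eval_def prod.distrib prod_inversef[symmetric] o_def)
  also have "\<dots> = (\<Prod>i\<in>{1..n}. \<Sum>x\<in>carrier (Gam r). x ^ ?l m i * inverse (x ^ ?l m' i))"
    by (rule prod_sum_PiE[symmetric]) (simp_all add: finite_Gam)
  also have "\<dots> = (\<Prod>i\<in>{1..n}. if ?l m i = ?l m' i then of_nat r else 0)"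
    using m by (intro prod.cong refl sum_Gam_power[OF r]) (auto simp: exponent_box_def)
  also have "\<dots> = (if \<forall>i\<in>{1..n}. ?l m i = ?l m' i then of_nat r ^ n else 0)"
    by (subst prod_if_eq_power) simp_all
  also have "(\<forall>i\<in>{1..n}. ?l m i = ?l m' i) \<longleftrightarrow> m = m'"
    using exponent_box_eqI[OF m] by blast
  finally show ?thesis .
qed

text \<open>The second orthogonality relation, with points and characters exchanged; it factors in
  the same way and yields Fourier inversion.\<close>

lemma monom_eval_complete:
  assumes r: "r \<ge> 1" and g: "g \<in> carrier (Gam_pow r n)" "h \<in> carrier (Gam_pow r n)"
  shows "(\<Sum>m\<in>exponent_box r n. monom_eval n m g * inverse (monom_eval n m h)) =
    (if g = h then of_nat r ^ n else 0)"
proof -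
  let ?l = "Poly_Mapping.lookup"
  have "(\<Sum>m\<in>exponent_box r n. monom_eval n m g * inverse (monom_eval n m h)) =
      (\<Sum>m\<in>exponent_box r n. \<Prod>i\<in>{1..n}. g i ^ (\<lambda>i\<in>{1..n}. ?l m i) i * inverse (h i ^ (\<lambda>i\<in>{1..n}. ?l m i) i))"
    by (simp add: monom_eval_def prod.distrib prod_inversef[symmetric] o_def)
  also have "\<dots> = (\<Sum>a\<in>(\<Pi>\<^sub>E i\<in>{1..n}. {..<r}). \<Prod>i\<in>{1..n}. g i ^ a i * inverse (h i ^ a i))"
    by (rule sum.reindex_bij_betw[OF bij_betw_exponent_box])
  also have "\<dots> = (\<Prod>i\<in>{1..n}. \<Sum>a<r. g i ^ a * inverse (h i ^ a))"
    by (rule prod_sum_PiE[symmetric]) simp_all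
  also have "\<dots> = (\<Prod>i\<in>{1..n}. if g i = h i then of_nat r else 0)"
    using g by (intro prod.cong refl sum_power_Gam[OF r]) (auto simp: carrier_Gam_pow)
  also have "\<dots> = (if \<forall>i\<in>{1..n}. g i = h i then of_nat r ^ n else 0)"
    by (subst prod_if_eq_power) simp_all
  also have "(\<forall>i\<in>{1..n}. g i = h i) \<longleftrightarrow> g = h"
    using g unfolding carrier_Gam_pow by (metis PiE_ext)
  finally show ?thesis .
qed

section \<open>The modules as representations of the wreath product\<close>

lemma wreath_carrier: "(g, \<sigma>) \<in> carrier (wreath r n) \<longleftrightarrow> g \<in> carrier (Gam_pow r n) \<and> \<sigma> permutes {1..n}"
  by (simp add: wreath_def semidirect_def sym_group_def)

lemma wreath_mult: "(g, \<sigma>) \<otimes>\<^bsub>wreath r n\<^esub> (h, \<tau>) = (g \<otimes>\<^bsub>Gam_pow r n\<^esub> perm_act n \<sigma> h, \<sigma> \<circ> \<tau>)"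
  by (simp add: wreath_def semidirect_def sym_group_def)

lemma wreath_one: "\<one>\<^bsub>wreath r n\<^esub> = (\<lambda>i\<in>{1..n}. 1, id)"
  by (simp add: wreath_def semidirect_def sym_group_def Gam_pow_def Gam_def)

text \<open>This compatibility of S_n with the characters is what makes the action multiplicative on
  the semidirect product.\<close>

lemma monom_eval_perm_act:
  assumes "\<sigma> permutes {1..n}"
  shows "monom_eval n m (perm_act n \<sigma> h) = monom_eval n (Poly_Mapping.map_key \<sigma> m) h"
proof -
  have "monom_eval n (Poly_Mapping.map_key \<sigma> m) h =
      monom_eval n (Poly_Mapping.map_key \<sigma> m) (\<lambda>i. perm_act n \<sigma> h (\<sigma> i))"
    using permutes_in_image[OF assms]
    by (intro monom_eval_cong) (simp add: perm_act_def permutes_inverses[OF assms] del: atLeastAtMost_iff)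
  then show ?thesis by (simp only: monom_eval_map_key[OF assms])
qed

lemma monom_eval_Gam_pow_mult:
  "monom_eval n m (g \<otimes>\<^bsub>Gam_pow r n\<^esub> h) = monom_eval n m g * monom_eval n m h"
  unfolding monom_eval_mult[symmetric] by (rule monom_eval_cong) (rule Gam_pow_mult)

lemma CM_sel [simp]: "rscale (CM n k) = cscale"
  by (simp add: CM_def)

lemma rspace_CM: "sum_list k = n \<Longrightarrow> rspace (CM n k) = {p. Poly_Mapping.keys p \<subseteq> exponents n k}"
  by (simp add: CM_def Mon_eq span_monomials)

lemma lookup_ract_CM_rspace:
  assumes "sum_list k = n" "p \<in> rspace (CM n k)" "\<sigma> permutes {1..n}"
  shows "Poly_Mapping.lookup (ract (CM n k) (g, \<sigma>) p) m =
    inverse (monom_eval n m g) * Poly_Mapping.lookup p (Poly_Mapping.map_key \<sigma> m)"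
  using assms by (intro lookup_ract_CM) (auto simp: rspace_CM exponents_def)

lemma is_rep_CM:
  assumes r: "r \<ge> 1" and k: "sum_list k = n"
  shows "is_rep (wreath r n) (CM n k)"
proof (rule is_repI[OF group_wreath[OF r]])
  note sp = rspace_CM[OF k] and act = lookup_ract_CM_rspace[OF k]
  show "vector_space (rscale (CM n k))" by (simp add: vector_space_cscale)
  show zero: "0 \<in> rspace (CM n k)" by (simp add: sp)
  show add: "u + v \<in> rspace (CM n k)" if "u \<in> rspace (CM n k)" "v \<in> rspace (CM n k)" for u v
    using that by (simp add: sp keys_subset_iff lookup_add)
  show scale: "rscale (CM n k) c v \<in> rspace (CM n k)" if "v \<in> rspace (CM n k)" for c v
    using that by (simp add: sp keys_subset_iff)
  show closed: "ract (CM n k) x v \<in> rspace (CM n k)"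
    if x: "x \<in> carrier (wreath r n)" and v: "v \<in> rspace (CM n k)" for x v
  proof -
    obtain g \<sigma> where x: "x = (g, \<sigma>)" "\<sigma> permutes {1..n}"
      using x by (cases x) (simp add: wreath_carrier)
    have "Poly_Mapping.lookup v m = 0" if "m \<notin> exponents n k" for m
      using that v by (simp add: sp keys_subset_iff)
    then have "Poly_Mapping.lookup (ract (CM n k) x v) m = 0" if "m \<notin> exponents n k" for m
      using that x by (simp add: act[OF v] map_key_mem_exponents)
    then show ?thesis by (simp add: sp keys_subset_iff)
  qed
  show "ract (CM n k) x (u + v) = ract (CM n k) x u + ract (CM n k) x v"
    if "x \<in> carrier (wreath r n)" "u \<in> rspace (CM n k)" "v \<in> rspace (CM n k)" for x u v
    using that add by (cases x) (auto intro!: poly_mapping_eqI simp: wreath_carrier act lookup_add algebra_simps)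
  show "ract (CM n k) x (rscale (CM n k) c v) = rscale (CM n k) c (ract (CM n k) x v)"
    if "x \<in> carrier (wreath r n)" "v \<in> rspace (CM n k)" for x c v
    using that scale[OF that(2), of c] by (cases x) (auto intro!: poly_mapping_eqI simp: wreath_carrier act)
  show "ract (CM n k) \<one>\<^bsub>wreath r n\<^esub> v = v" if "v \<in> rspace (CM n k)" for v
  proof (rule poly_mapping_eqI)
    fix m :: "nat \<Rightarrow>\<^sub>0 nat"
    have "Poly_Mapping.map_key id m = m" using map_key_id by (simp add: id_def)
    moreover have "monom_eval n m (\<lambda>i\<in>{1..n}. 1) = 1" by (simp add: monom_eval_def)
    ultimately show "Poly_Mapping.lookup (ract (CM n k) \<one>\<^bsub>wreath r n\<^esub> v) m = Poly_Mapping.lookup v m"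
      using that by (simp add: wreath_one act permutes_id del: One_nat_def)
  qed
  show "ract (CM n k) (x \<otimes>\<^bsub>wreath r n\<^esub> y) v = ract (CM n k) x (ract (CM n k) y v)"
    if xy: "x \<in> carrier (wreath r n)" "y \<in> carrier (wreath r n)" and v: "v \<in> rspace (CM n k)" for x y v
  proof (rule poly_mapping_eqI)
    fix m :: "nat \<Rightarrow>\<^sub>0 nat"
    obtain g \<sigma> h \<tau> where x: "x = (g, \<sigma>)" "\<sigma> permutes {1..n}" and y: "y = (h, \<tau>)" "\<tau> permutes {1..n}"
      using xy by (cases x, cases y) (simp add: wreath_carrier)
    \<comment> \<open>At m both sides involve the coefficient of v at m o sigma o tau; the scalars
      agree because the character m at sigma(h) is the character m o sigma at h.\<close>
    have "Poly_Mapping.map_key \<tau> (Poly_Mapping.map_key \<sigma> m) = Poly_Mapping.map_key (\<sigma> \<circ> \<tau>) m"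
      using x y by (intro map_key_compose permutes_inj)
    moreover have "ract (CM n k) (h, \<tau>) v \<in> rspace (CM n k)" using closed[OF xy(2) v] y by simp
    ultimately show "Poly_Mapping.lookup (ract (CM n k) (x \<otimes>\<^bsub>wreath r n\<^esub> y) v) m =
        Poly_Mapping.lookup (ract (CM n k) x (ract (CM n k) y v)) m"
      using x y v by (simp add: wreath_mult act permutes_compose monom_eval_Gam_pow_mult monom_eval_perm_act)
  qed
qed

lemma lookup_ract_CM_diagonal:
  assumes "sum_list k = n" "p \<in> rspace (CM n k)"
  shows "Poly_Mapping.lookup (ract (CM n k) (g, id) p) m =
    inverse (monom_eval n m g) * Poly_Mapping.lookup p m"
  using lookup_ract_CM_rspace[OF assms permutes_id] map_key_id[of m] by (simp add: id_def)

lemma monomial_mem_rspace_CM: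
  "sum_list k = n \<Longrightarrow> m \<in> exponents n k \<Longrightarrow> Poly_Mapping.single m c \<in> rspace (CM n k)"
  by (auto simp: rspace_CM keys_subset_iff lookup_single when_def)

lemma irreducible_rep_CM:
  assumes r: "r \<ge> 1" and k: "k \<in> compositions r n"
  shows "irreducible_rep (wreath r n) (CM n k)"
proof -
  have kn: "sum_list k = n" and kr: "length k = r" using k by (auto simp: compositions_def)
  note sp = rspace_CM[OF kn]
  have box: "m \<in> exponent_box r n" if "m \<in> exponents n k" for m
    using exponents_subset_box that kr by blast
  interpret vector_space cscale by (rule vector_space_cscale)
  obtain m0 where m0: "m0 \<in> exponents n k" using exponents_nonempty[OF kn] by blast
  have "rspace (CM n k) \<noteq> {0}"
    using monomial_mem_rspace_CM[OF kn m0, of 1] by (metis lookup_single_eq lookup_zero singletonD zero_neq_one)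
  moreover have "W = {0} \<or> W = rspace (CM n k)"
    if W: "W \<subseteq> rspace (CM n k)" "subspace W" and inv: "\<forall>x\<in>carrier (wreath r n). ract (CM n k) x ` W \<subseteq> W" for W
  proof (cases "W = {0}")
    case False
    then obtain p where p: "p \<in> W" "p \<noteq> 0" using subspace_0[OF W(2)] by blast
    then obtain m where m: "Poly_Mapping.lookup p m \<noteq> 0" by (metis poly_mapping_eqI lookup_zero)
    have pV: "p \<in> rspace (CM n k)" using p W by blast
    then have mE: "m \<in> exponents n k" using m by (auto simp: sp in_keys_iff)
    let ?c = "of_nat r ^ n * Poly_Mapping.lookup p m"
    \<comment> \<open>Weighting by the character m cancels the inverse that the action introduces at
      m and leaves a vanishing character sum at the other exponents of p. What survives is the
      coefficient at m, times r^n.\<close>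
    define q where "q = (\<Sum>g\<in>carrier (Gam_pow r n). cscale (monom_eval n m g) (ract (CM n k) (g, id) p))"
    have "ract (CM n k) (g, id) p \<in> W" if "g \<in> carrier (Gam_pow r n)" for g
      using inv that p(1) permutes_id by (force simp: wreath_carrier)
    then have "q \<in> W" unfolding q_def by (intro subspace_sum[OF W(2)] subspace_scale[OF W(2)])
    moreover have "q = Poly_Mapping.single m ?c"
    proof (rule poly_mapping_eqI)
      fix m'
      have "Poly_Mapping.lookup q m' =
          (\<Sum>g\<in>carrier (Gam_pow r n). monom_eval n m g * inverse (monom_eval n m' g)) * Poly_Mapping.lookup p m'"
        by (simp add: q_def lookup_sum lookup_ract_CM_diagonal[OF kn pV] sum_distrib_left mult_ac)
      also have "\<dots> = Poly_Mapping.lookup (Poly_Mapping.single m ?c) m'"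
      proof (cases "m' \<in> exponents n k")
        case True
        show ?thesis
          by (simp add: monom_eval_orthogonal[OF r box[OF mE] box[OF True]] lookup_single)
      next
        case False
        \<comment> \<open>Here m' may lie outside the box, where orthogonality says nothing, but p
          has no coefficient there.\<close>
        then have "Poly_Mapping.lookup p m' = 0" "m' \<noteq> m" using pV mE by (auto simp: sp keys_subset_iff)
        then show ?thesis by (simp add: lookup_single)
      qed
      finally show "Poly_Mapping.lookup q m' = Poly_Mapping.lookup (Poly_Mapping.single m ?c) m'" .
    qed
    ultimately have "cscale (inverse ?c) (Poly_Mapping.single m ?c) \<in> W"
      by (intro subspace_scale[OF W(2)]) simp
    moreover have "inverse ?c * ?c = 1" using m r by (intro left_inverse) simp
    ultimately have mW: "Poly_Mapping.single m 1 \<in> W" by (simp only: cscale_single)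
    have "Poly_Mapping.single m' 1 \<in> W" if m': "m' \<in> exponents n k" for m'
    proof -
      obtain \<sigma> where \<sigma>: "\<sigma> permutes {1..n}" "Poly_Mapping.map_key \<sigma> m' = m"
        using exponents_transitive[OF mE m'] .
      \<comment> \<open>Composition with sigma is injective, so the permutation sends the monomial m
        to the monomial m' alone.\<close>
      have \<sigma>': "Poly_Mapping.map_key \<sigma> a = m \<longleftrightarrow> a = m'" for a
      proof
        assume a: "Poly_Mapping.map_key \<sigma> a = m"
        show "a = m'"
        proof (rule poly_mapping_eqI)
          fix i
          have "Poly_Mapping.lookup (Poly_Mapping.map_key \<sigma> a) (inv' \<sigma> i) =
              Poly_Mapping.lookup (Poly_Mapping.map_key \<sigma> m') (inv' \<sigma> i)" using a \<sigma>(2) by simp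
          then show "Poly_Mapping.lookup a i = Poly_Mapping.lookup m' i"
            by (simp add: map_key.rep_eq[OF permutes_inj[OF \<sigma>(1)]] permutes_inverses[OF \<sigma>(1)])
        qed
      qed (simp add: \<sigma>(2))
      let ?x = "(\<lambda>i\<in>{1..n}. 1, \<sigma>)"
      have one: "monom_eval n a (\<lambda>i\<in>{1..n}. 1) = 1" for a by (simp add: monom_eval_def)
      have "(\<lambda>i\<in>{1..n}. 1) \<in> carrier (Gam_pow r n)"
        unfolding carrier_Gam_pow using r by (auto simp: carrier_Gam simp del: One_nat_def)
      then have x: "?x \<in> carrier (wreath r n)" using \<sigma>(1) by (simp add: wreath_carrier)
      have "ract (CM n k) ?x (Poly_Mapping.single m 1) = Poly_Mapping.single m' 1"
        by (rule poly_mapping_eqI)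
          (auto simp: lookup_ract_CM_rspace[OF kn monomial_mem_rspace_CM[OF kn mE] \<sigma>(1)] one lookup_single \<sigma>' when_def eq_commute[of m]
            simp del: One_nat_def)
      then show ?thesis using inv x mW by (metis image_subset_iff)
    qed
    then have "span ((\<lambda>m. Poly_Mapping.single m 1) ` exponents n k) \<subseteq> W"
      using W(2) by (intro span_minimal) auto
    then have "rspace (CM n k) \<subseteq> W" by (simp add: sp span_monomials)
    then show ?thesis using W(1) by blast
  qed simp
  ultimately show ?thesis
    using is_rep_CM[OF r kn] by (auto simp: irreducible_rep_def)
qed

text \<open>Gamma^n acts on the image of the monomial m through the character m, so an exponent m'
  in its support carries the same character. Orthogonality gives m = m', and m determines k.\<close>

lemma rep_iso_CM_imp_eq:
  assumes r: "r \<ge> 1" and k: "k \<in> compositions r n" "k' \<in> compositions r n"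
    and iso: "rep_iso (wreath r n) (CM n k) (CM n k')"
  shows "k = k'"
proof -
  have kn: "sum_list k = n" "sum_list k' = n" and kr: "length k = r" "length k' = r"
    using k by (auto simp: compositions_def)
  obtain T where bij: "bij_betw T (rspace (CM n k)) (rspace (CM n k'))"
    and lin: "linear_map_on cscale cscale (rspace (CM n k)) T"
    and eqv: "\<And>x v. x \<in> carrier (wreath r n) \<Longrightarrow> v \<in> rspace (CM n k) \<Longrightarrow> T (ract (CM n k) x v) = ract (CM n k') x (T v)"
    using iso by (auto simp: rep_iso_def)
  obtain m where m: "m \<in> exponents n k" using exponents_nonempty[OF kn(1)] by blast
  let ?p = "Poly_Mapping.single m (1::complex)"
  have p: "?p \<in> rspace (CM n k)" by (rule monomial_mem_rspace_CM[OF kn(1) m])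
  have q: "T ?p \<in> rspace (CM n k')" using bij p by (auto simp: bij_betw_def)
  have z: "0 \<in> rspace (CM n k)" by (simp add: rspace_CM[OF kn(1)])
  have T0: "T 0 = 0"
    using lin z unfolding linear_map_on_def by (metis add_cancel_right_right add_0)
  have "?p \<noteq> 0" by (metis lookup_single_eq lookup_zero zero_neq_one)
  then have "T ?p \<noteq> 0" using bij_betw_imp_inj_on[OF bij] p z T0 by (metis inj_onD)
  then obtain m' where m': "Poly_Mapping.lookup (T ?p) m' \<noteq> 0" by (metis poly_mapping_eqI lookup_zero)
  have m'E: "m' \<in> exponents n k'" using q m' by (auto simp: rspace_CM[OF kn(2)] in_keys_iff)
  have box: "m \<in> exponent_box r n" "m' \<in> exponent_box r n"
    using exponents_subset_box[of n k] exponents_subset_box[of n k'] m m'E kr by auto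
  have eq: "inverse (monom_eval n m' g) = inverse (monom_eval n m g)" if g: "g \<in> carrier (Gam_pow r n)" for g
  proof -
    have x: "(g, id) \<in> carrier (wreath r n)" using g by (simp add: wreath_carrier permutes_id)
    have "ract (CM n k) (g, id) ?p = cscale (inverse (monom_eval n m g)) ?p"
      by (rule poly_mapping_eqI)
        (simp add: lookup_ract_CM_diagonal[OF kn(1) p] lookup_single when_def)
    then have "ract (CM n k') (g, id) (T ?p) = cscale (inverse (monom_eval n m g)) (T ?p)"
      using eqv[OF x p] lin p by (simp add: linear_map_on_def del: cscale_single)
    then have "Poly_Mapping.lookup (ract (CM n k') (g, id) (T ?p)) m' =
        inverse (monom_eval n m g) * Poly_Mapping.lookup (T ?p) m'" by simp
    then show ?thesis using m' by (simp add: lookup_ract_CM_diagonal[OF kn(2) q])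
  qed
  \<comment> \<open>As the characters agree, the sum for m and m' equals the one for m with itself,
    which is r^n and not zero.\<close>
  have "(if m = m' then of_nat r ^ n else 0) = (of_nat r ^ n :: complex)"
    using monom_eval_orthogonal[OF r box] monom_eval_orthogonal[OF r box(1) box(1)]
    by (simp add: eq cong: sum.cong)
  then have "m = m'" using r by (auto split: if_splits)
  then show ?thesis using exponents_unique[OF m] m'E kr by simp
qed

lemma monom_eval_const: "monom_eval n m (\<lambda>i\<in>{1..n}. c) = c ^ (\<Sum>i\<in>{1..n}. Poly_Mapping.lookup m i)"
  by (simp add: monom_eval_def power_sum del: One_nat_def)

lemma acts_trivially_diag_CM:
  assumes r: "r \<ge> 1" and k: "k \<in> compositions r n"
  shows "acts_trivially (diag_subgroup r n) (CM n k) \<longleftrightarrow> r dvd (\<Sum>i<r. i * k ! i)"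
proof
  have kn: "sum_list k = n" and kr: "length k = r" using k by (auto simp: compositions_def)
  have deg: "monom_eval n m (\<lambda>i\<in>{1..n}. c) = c ^ (\<Sum>i<r. i * k ! i)" if "m \<in> exponents n k" for m c
    using sum_exponents[OF that] kr by (simp only: monom_eval_const)
  {
    assume triv: "acts_trivially (diag_subgroup r n) (CM n k)"
    obtain m where m: "m \<in> exponents n k" using exponents_nonempty[OF kn] by blast
    let ?p = "Poly_Mapping.single m (1::complex)"
    have p: "?p \<in> rspace (CM n k)" by (rule monomial_mem_rspace_CM[OF kn m])
    \<comment> \<open>Testing the generator xi on a single monomial suffices, since xi has order
      exactly r.\<close>
    have "(\<lambda>i\<in>{1..n}. xi r, id) \<in> diag_subgroup r n"
      unfolding diag_subgroup_def Gam_diag_def using xi_mem_Gam[OF r] by blast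
    then have "ract (CM n k) (\<lambda>i\<in>{1..n}. xi r, id) ?p = ?p"
      using triv p by (simp only: acts_trivially_def)
    then have "Poly_Mapping.lookup (ract (CM n k) (\<lambda>i\<in>{1..n}. xi r, id) ?p) m = 1" by simp
    then have "xi r ^ (\<Sum>i<r. i * k ! i) = 1"
      by (simp add: lookup_ract_CM_diagonal[OF kn p] deg[OF m] del: One_nat_def)
    then show "r dvd (\<Sum>i<r. i * k ! i)" by (simp add: xi_power_eq_1_iff[OF r])
  }
  {
    assume "r dvd (\<Sum>i<r. i * k ! i)"
    then have pow: "c ^ (\<Sum>i<r. i * k ! i) = 1" if "c \<in> carrier (Gam r)" for c
      using that by (elim dvdE) (simp add: carrier_Gam[OF r] power_mult)
    show "acts_trivially (diag_subgroup r n) (CM n k)"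
      unfolding acts_trivially_def
    proof (intro ballI)
      fix x v assume x: "x \<in> diag_subgroup r n" and v: "v \<in> rspace (CM n k)"
      then obtain c where c: "x = (\<lambda>i\<in>{1..n}. c, id)" "c \<in> carrier (Gam r)"
        by (auto simp: diag_subgroup_def Gam_diag_def)
      show "ract (CM n k) x v = v"
      proof (rule poly_mapping_eqI)
        fix m
        show "Poly_Mapping.lookup (ract (CM n k) x v) m = Poly_Mapping.lookup v m"
        proof (cases "m \<in> exponents n k")
          case True
          show ?thesis unfolding c(1) lookup_ract_CM_diagonal[OF kn v] deg[OF True] pow[OF c(2)] by simp
        next
          case False
          then have "Poly_Mapping.lookup v m = 0" using v by (simp add: rspace_CM[OF kn] keys_subset_iff)
          then show ?thesis unfolding c(1) lookup_ract_CM_diagonal[OF kn v] by simp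
        qed
      qed
    qed
  }
qed

section \<open>Fourier inversion and the induced representation\<close>

definition poly_eval :: "nat \<Rightarrow> cpoly \<Rightarrow> (nat \<Rightarrow> complex) \<Rightarrow> complex" where
  "poly_eval n p x = (\<Sum>m\<in>Poly_Mapping.keys p. Poly_Mapping.lookup p m * monom_eval n m x)"

lemma poly_eval_superset:
  assumes "finite A" "Poly_Mapping.keys p \<subseteq> A"
  shows "poly_eval n p x = (\<Sum>m\<in>A. Poly_Mapping.lookup p m * monom_eval n m x)"
  unfolding poly_eval_def using assms by (intro sum.mono_neutral_left) (auto simp: in_keys_iff)

lemma poly_eval_add: "poly_eval n (p + q) x = poly_eval n p x + poly_eval n q x"
proof -
  let ?A = "Poly_Mapping.keys p \<union> Poly_Mapping.keys q"
  have "poly_eval n (p + q) x = (\<Sum>m\<in>?A. Poly_Mapping.lookup (p + q) m * monom_eval n m x)"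
    using keys_add[of p q] by (intro poly_eval_superset) auto
  also have "\<dots> = poly_eval n p x + poly_eval n q x"
    by (simp add: poly_eval_superset[of ?A] lookup_add algebra_simps sum.distrib)
  finally show ?thesis .
qed

lemma poly_eval_cscale: "poly_eval n (cscale c p) x = c * poly_eval n p x"
proof -
  have "poly_eval n (cscale c p) x = (\<Sum>m\<in>Poly_Mapping.keys p. Poly_Mapping.lookup (cscale c p) m * monom_eval n m x)"
    by (intro poly_eval_superset) (auto simp: in_keys_iff)
  then show ?thesis by (simp add: poly_eval_def sum_distrib_left mult.assoc)
qed

lemma Gam_pow_one: "\<one>\<^bsub>Gam_pow r n\<^esub> = (\<lambda>i\<in>{1..n}. 1)"
  by (simp add: Gam_pow_def Gam_def)

lemma monom_eval_nonzero:
  assumes "r \<ge> 1" "g \<in> carrier (Gam_pow r n)"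
  shows "monom_eval n m g \<noteq> 0"
  using Gam_nonzero[OF assms(1)] assms(2) by (auto simp: monom_eval_def carrier_Gam_pow)

lemma bij_betw_map_key_exponents:
  assumes \<sigma>: "\<sigma> permutes {1..n}"
  shows "bij_betw (Poly_Mapping.map_key \<sigma>) (exponents n k) (exponents n k)"
proof (rule bij_betwI[where g = "Poly_Mapping.map_key (inv' \<sigma>)"])
  have inv: "inv' \<sigma> permutes {1..n}" by (rule permutes_inv[OF \<sigma>])
  show "Poly_Mapping.map_key (inv' \<sigma>) (Poly_Mapping.map_key \<sigma> m) = m"
    and "Poly_Mapping.map_key \<sigma> (Poly_Mapping.map_key (inv' \<sigma>) m) = m" for m :: "nat \<Rightarrow>\<^sub>0 nat"
    by (auto intro!: poly_mapping_eqI simp: map_key.rep_eq[OF permutes_inj[OF \<sigma>]]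
        map_key.rep_eq[OF permutes_inj[OF inv]] permutes_inverses[OF \<sigma>])
qed (use permutes_inv[OF \<sigma>] \<sigma> in \<open>auto simp: map_key_mem_exponents\<close>)

text \<open>The group sends the point g to h tau(g), and evaluation is unchanged when polynomial and
  point move together: the scalar of the action cancels the character value at h, and tau merely
  relabels the exponents.\<close>

lemma poly_eval_ract_CM:
  assumes r: "r \<ge> 1" and k: "sum_list k = n" and p: "p \<in> rspace (CM n k)"
    and h: "h \<in> carrier (Gam_pow r n)" and \<tau>: "\<tau> permutes {1..n}"
  shows "poly_eval n (ract (CM n k) (h, \<tau>) p) (h \<otimes>\<^bsub>Gam_pow r n\<^esub> perm_act n \<tau> g) = poly_eval n p g"
proof -
  let ?q = "ract (CM n k) (h, \<tau>) p"
  have "?q \<in> rspace (CM n k)"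
    using is_repD(7)[OF is_rep_CM[OF r k] _ p] h \<tau> by (simp add: wreath_carrier)
  then have "poly_eval n ?q (h \<otimes>\<^bsub>Gam_pow r n\<^esub> perm_act n \<tau> g) =
      (\<Sum>m\<in>exponents n k. Poly_Mapping.lookup ?q m * monom_eval n m (h \<otimes>\<^bsub>Gam_pow r n\<^esub> perm_act n \<tau> g))"
    by (intro poly_eval_superset finite_exponents) (simp add: rspace_CM[OF k])
  also have "\<dots> = (\<Sum>m\<in>exponents n k. Poly_Mapping.lookup p (Poly_Mapping.map_key \<tau> m) *
      monom_eval n (Poly_Mapping.map_key \<tau> m) g)"
    by (rule sum.cong) (simp_all add: lookup_ract_CM_rspace[OF k p \<tau>] monom_eval_Gam_pow_mult
        monom_eval_perm_act[OF \<tau>] monom_eval_nonzero[OF r h])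
  also have "\<dots> = (\<Sum>m\<in>exponents n k. Poly_Mapping.lookup p m * monom_eval n m g)"
    by (rule sum.reindex_bij_betw[OF bij_betw_map_key_exponents[OF \<tau>]])
  also have "\<dots> = poly_eval n p g"
    using p by (intro poly_eval_superset[symmetric] finite_exponents) (simp add: rspace_CM[OF k])
  finally show ?thesis .
qed

text \<open>A diagonal element multiplies every monomial of the module by c to the common degree,
  which is 1 here. Evaluation is thus well defined on cosets of the diagonal.\<close>

lemma poly_eval_diag:
  assumes r: "r \<ge> 1" and k: "k \<in> compositions r n" and dvd: "r dvd (\<Sum>i<r. i * k ! i)"
    and p: "p \<in> rspace (CM n k)" and d: "d \<in> Gam_diag r n"
  shows "poly_eval n p (d \<otimes>\<^bsub>Gam_pow r n\<^esub> g) = poly_eval n p g"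
proof -
  have kn: "sum_list k = n" and kr: "length k = r" using k by (auto simp: compositions_def)
  obtain c where c: "d = (\<lambda>i\<in>{1..n}. c)" "c \<in> carrier (Gam r)" using d by (auto simp: Gam_diag_def)
  have "c ^ (\<Sum>i<r. i * k ! i) = 1"
    using dvd c(2) by (elim dvdE) (simp add: carrier_Gam[OF r] power_mult)
  then have "monom_eval n m d = 1" if "m \<in> exponents n k" for m
    using sum_exponents[OF that] kr by (simp only: monom_eval_const c(1))
  moreover have "Poly_Mapping.keys p \<subseteq> exponents n k" using p by (simp add: rspace_CM[OF kn])
  ultimately show ?thesis
    unfolding poly_eval_def by (intro sum.cong) (auto simp: monom_eval_Gam_pow_mult)
qed

lemma sum_Gam_pow_translate:
  assumes r: "r \<ge> 1" and d: "d \<in> carrier (Gam_pow r n)"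
  shows "(\<Sum>g\<in>carrier (Gam_pow r n). f (d \<otimes>\<^bsub>Gam_pow r n\<^esub> g)) = (\<Sum>g\<in>carrier (Gam_pow r n). f g)"
proof -
  interpret P: comm_group "Gam_pow r n" by (rule comm_group_Gam_pow[OF r])
  have "bij_betw (\<lambda>g. d \<otimes>\<^bsub>Gam_pow r n\<^esub> g) (carrier (Gam_pow r n)) (carrier (Gam_pow r n))"
    using P.inj_on_cmult[OF d] P.surj_const_mult[OF d] by (simp add: bij_betw_def)
  then show ?thesis by (rule sum.reindex_bij_betw)
qed

text \<open>The divisor is the order of Gamma^n, so that no factor appears in the inversion
  formula.\<close>

definition fourier_coeff :: "nat \<Rightarrow> nat \<Rightarrow> ((nat \<Rightarrow> complex) \<Rightarrow> complex) \<Rightarrow> (nat \<Rightarrow>\<^sub>0 nat) \<Rightarrow> complex" where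
  "fourier_coeff r n f m =
     (\<Sum>g\<in>carrier (Gam_pow r n). f g * inverse (monom_eval n m g)) / of_nat r ^ n"

lemma fourier_inversion:
  assumes r: "r \<ge> 1" and g: "g \<in> carrier (Gam_pow r n)"
  shows "(\<Sum>m\<in>exponent_box r n. fourier_coeff r n f m * monom_eval n m g) = f g"
proof -
  have "(\<Sum>m\<in>exponent_box r n. fourier_coeff r n f m * monom_eval n m g) =
      (\<Sum>m\<in>exponent_box r n. \<Sum>h\<in>carrier (Gam_pow r n).
        f h * (monom_eval n m g * inverse (monom_eval n m h)) / of_nat r ^ n)"
    by (simp add: fourier_coeff_def sum_divide_distrib sum_distrib_left sum_distrib_right mult_ac)
  also have "\<dots> = (\<Sum>h\<in>carrier (Gam_pow r n). \<Sum>m\<in>exponent_box r n.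
        f h * (monom_eval n m g * inverse (monom_eval n m h)) / of_nat r ^ n)"
    by (rule sum.swap)
  also have "\<dots> = (\<Sum>h\<in>carrier (Gam_pow r n). f h / of_nat r ^ n *
      (\<Sum>m\<in>exponent_box r n. monom_eval n m g * inverse (monom_eval n m h)))"
    by (simp add: sum_distrib_left mult_ac)
  also have "\<dots> = (\<Sum>h\<in>carrier (Gam_pow r n). if g = h then f g else 0)"
    using r by (intro sum.cong refl) (auto simp: monom_eval_complete[OF r g])
  also have "\<dots> = f g" using g by (simp add: finite_Gam_pow)
  finally show ?thesis .
qed

lemma fourier_coeff_poly_eval:
  assumes r: "r \<ge> 1" and p: "Poly_Mapping.keys p \<subseteq> exponent_box r n" and m: "m \<in> exponent_box r n"
  shows "fourier_coeff r n (poly_eval n p) m = Poly_Mapping.lookup p m"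
proof -
  have "(\<Sum>g\<in>carrier (Gam_pow r n). poly_eval n p g * inverse (monom_eval n m g)) =
      (\<Sum>g\<in>carrier (Gam_pow r n). \<Sum>m'\<in>exponent_box r n.
        Poly_Mapping.lookup p m' * (monom_eval n m' g * inverse (monom_eval n m g)))"
    by (simp add: poly_eval_superset[OF finite_exponent_box p] sum_distrib_right mult.assoc)
  also have "\<dots> = (\<Sum>m'\<in>exponent_box r n. Poly_Mapping.lookup p m' *
      (\<Sum>g\<in>carrier (Gam_pow r n). monom_eval n m' g * inverse (monom_eval n m g)))"
    by (subst sum.swap) (simp add: sum_distrib_left)
  also have "\<dots> = (\<Sum>m'\<in>exponent_box r n. if m' = m then Poly_Mapping.lookup p m * of_nat r ^ n else 0)"
    by (intro sum.cong refl) (simp add: monom_eval_orthogonal[OF r _ m])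
  also have "\<dots> = Poly_Mapping.lookup p m * of_nat r ^ n"
    using m by (simp add: finite_exponent_box)
  finally show ?thesis using r by (simp add: fourier_coeff_def)
qed

text \<open>Translation by the diagonal element of xi leaves f unchanged but multiplies the sum by a
  power of xi other than 1. So an invariant f has no component in the modules that do not
  descend.\<close>

lemma fourier_coeff_diag_invariant:
  assumes r: "r \<ge> 1" and k: "k \<in> compositions r n" and m: "m \<in> exponents n k"
    and inv: "\<And>d g. d \<in> Gam_diag r n \<Longrightarrow> g \<in> carrier (Gam_pow r n) \<Longrightarrow> f (d \<otimes>\<^bsub>Gam_pow r n\<^esub> g) = f g"
    and ndvd: "\<not> r dvd (\<Sum>i<r. i * k ! i)"
  shows "fourier_coeff r n f m = 0"
proof -
  let ?N = "\<Sum>i<r. i * k ! i"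
  let ?S = "\<Sum>g\<in>carrier (Gam_pow r n). f g * inverse (monom_eval n m g)"
  define d where "d = (\<lambda>i\<in>{1..n}. xi r)"
  have kr: "length k = r" using k by (auto simp: compositions_def)
  have d: "d \<in> Gam_diag r n" unfolding d_def Gam_diag_def using xi_mem_Gam[OF r] by blast
  then have dc: "d \<in> carrier (Gam_pow r n)" using subgroup.mem_carrier[OF subgroup_Gam_diag[OF r]] by blast
  have md: "monom_eval n m d = xi r ^ ?N"
    using sum_exponents[OF m] kr by (simp only: monom_eval_const d_def)
  have "?S = (\<Sum>g\<in>carrier (Gam_pow r n). f (d \<otimes>\<^bsub>Gam_pow r n\<^esub> g) * inverse (monom_eval n m (d \<otimes>\<^bsub>Gam_pow r n\<^esub> g)))"
    by (rule sum_Gam_pow_translate[OF r dc, symmetric])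
  also have "\<dots> = inverse (xi r ^ ?N) * ?S"
    by (simp add: inv[OF d] monom_eval_Gam_pow_mult md sum_distrib_left mult_ac cong: sum.cong)
  finally have "(inverse (xi r ^ ?N) - 1) * ?S = 0" by (simp add: algebra_simps)
  moreover have "inverse (xi r ^ ?N) \<noteq> 1"
    using ndvd by (simp only: inverse_eq_1_iff xi_power_eq_1_iff[OF r] not_False_eq_True)
  ultimately show ?thesis by (simp add: fourier_coeff_def)
qed

section \<open>Cosets of the diagonal and the subgroup S_n\<close>

text \<open>The form in which well-definedness is used: the representative picked by
  \<open>SOME\<close> differs from g by a diagonal factor.\<close>

lemma Gam_diag_coset_some:
  assumes r: "r \<ge> 1" and g: "g \<in> carrier (Gam_pow r n)"
  obtains d where "d \<in> Gam_diag r n"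
    "(SOME h. h \<in> fst (wreath_proj r n (g, \<sigma>))) = d \<otimes>\<^bsub>Gam_pow r n\<^esub> g"
proof -
  interpret P: comm_group "Gam_pow r n" by (rule comm_group_Gam_pow[OF r])
  have "g \<in> Gam_diag r n #>\<^bsub>Gam_pow r n\<^esub> g"
    by (rule P.rcos_self[OF g subgroup_Gam_diag[OF r]])
  then have "(SOME h. h \<in> Gam_diag r n #>\<^bsub>Gam_pow r n\<^esub> g) \<in> Gam_diag r n #>\<^bsub>Gam_pow r n\<^esub> g"
    by (rule someI[where P = "\<lambda>h. h \<in> _"])
  then show thesis using that by (auto simp: r_coset_def wreath_proj_def)
qed

lemma wreath_proj_diag:
  assumes r: "r \<ge> 1" and d: "d \<in> Gam_diag r n" and g: "g \<in> carrier (Gam_pow r n)"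
  shows "wreath_proj r n (d \<otimes>\<^bsub>Gam_pow r n\<^esub> g, \<sigma>) = wreath_proj r n (g, \<sigma>)"
proof -
  interpret P: comm_group "Gam_pow r n" by (rule comm_group_Gam_pow[OF r])
  have "d \<otimes>\<^bsub>Gam_pow r n\<^esub> g \<in> Gam_diag r n #>\<^bsub>Gam_pow r n\<^esub> g"
    using d by (auto simp: r_coset_def)
  then have "Gam_diag r n #>\<^bsub>Gam_pow r n\<^esub> g = Gam_diag r n #>\<^bsub>Gam_pow r n\<^esub> (d \<otimes>\<^bsub>Gam_pow r n\<^esub> g)"
    by (rule P.repr_independence[OF _ g subgroup_Gam_diag[OF r]])
  then show ?thesis by (simp add: wreath_proj_def)
qed

lemma reduced_wreath_cases:
  assumes "r \<ge> 1" "y \<in> carrier (reduced_wreath r n)"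
  obtains g \<sigma> where "g \<in> carrier (Gam_pow r n)" "\<sigma> permutes {1..n}" "y = wreath_proj r n (g, \<sigma>)"
  using assms wreath_proj_identification(1)[OF assms(1), of n] wreath_carrier[of _ _ r n] by fastforce

lemma wreath_proj_mem:
  assumes "r \<ge> 1" "g \<in> carrier (Gam_pow r n)" "\<sigma> permutes {1..n}"
  shows "wreath_proj r n (g, \<sigma>) \<in> carrier (reduced_wreath r n)"
  using wreath_proj_identification(1)[OF assms(1), of n] wreath_carrier[of g \<sigma> r n] assms(2,3) by blast

lemma sym_subgroup_eq:
  assumes r: "r \<ge> 1"
  shows "sym_subgroup r n = {wreath_proj r n (\<one>\<^bsub>Gam_pow r n\<^esub>, \<sigma>) | \<sigma>. \<sigma> permutes {1..n}}"
proof -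
  interpret P: comm_group "Gam_pow r n" by (rule comm_group_Gam_pow[OF r])
  have "Gam_diag r n #>\<^bsub>Gam_pow r n\<^esub> \<one>\<^bsub>Gam_pow r n\<^esub> = \<one>\<^bsub>Gam_quot r n\<^esub>"
    using P.coset_mult_one subgroup.subset[OF subgroup_Gam_diag[OF r]] by (simp add: Gam_quot_def)
  then show ?thesis by (auto simp: sym_subgroup_def wreath_proj_def sym_group_def)
qed

lemma perm_act_one:
  assumes "\<sigma> permutes {1..n}"
  shows "perm_act n \<sigma> \<one>\<^bsub>Gam_pow r n\<^esub> = \<one>\<^bsub>Gam_pow r n\<^esub>"
  using inv_permutes_mem[OF assms] by (auto simp: perm_act_def Gam_pow_one fun_eq_iff simp del: One_nat_def)

lemma wreath_mult_sym:
  assumes "r \<ge> 1" "g \<in> carrier (Gam_pow r n)" "\<sigma> permutes {1..n}"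
  shows "(g, \<sigma>) \<otimes>\<^bsub>wreath r n\<^esub> (\<one>\<^bsub>Gam_pow r n\<^esub>, \<tau>) = (g, \<sigma> \<circ> \<tau>)"
proof -
  interpret P: comm_group "Gam_pow r n" by (rule comm_group_Gam_pow[OF assms(1)])
  show ?thesis using assms by (simp add: wreath_mult perm_act_one)
qed

lemma wreath_proj_mult_sym:
  assumes r: "r \<ge> 1" and g: "g \<in> carrier (Gam_pow r n)" and \<sigma>: "\<sigma> permutes {1..n}" and \<tau>: "\<tau> permutes {1..n}"
  shows "wreath_proj r n (g, \<sigma>) \<otimes>\<^bsub>reduced_wreath r n\<^esub> wreath_proj r n (\<one>\<^bsub>Gam_pow r n\<^esub>, \<tau>) =
    wreath_proj r n (g, \<sigma> \<circ> \<tau>)"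
proof -
  interpret h: group_hom "wreath r n" "reduced_wreath r n" "wreath_proj r n" by (rule wreath_proj_hom[OF r])
  interpret P: comm_group "Gam_pow r n" by (rule comm_group_Gam_pow[OF r])
  have "(g, \<sigma>) \<in> carrier (wreath r n)" "(\<one>\<^bsub>Gam_pow r n\<^esub>, \<tau>) \<in> carrier (wreath r n)"
    using g \<sigma> \<tau> by (simp_all add: wreath_carrier)
  then show ?thesis using wreath_mult_sym[OF r g \<sigma>, of \<tau>] h.hom_mult by metis
qed

lemma subgroup_sym_subgroup:
  assumes r: "r \<ge> 1"
  shows "subgroup (sym_subgroup r n) (reduced_wreath r n)"
proof -
  interpret P: comm_group "Gam_pow r n" by (rule comm_group_Gam_pow[OF r])
  let ?j = "\<lambda>\<sigma>. wreath_proj r n (\<one>\<^bsub>Gam_pow r n\<^esub>, \<sigma>)"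
  have "group_hom (sym_group n) (reduced_wreath r n) ?j"
    unfolding group_hom_def group_hom_axioms_def
  proof (intro conjI sym_group_is_group group_reduced_wreath[OF r] homI)
    fix \<sigma> assume "\<sigma> \<in> carrier (sym_group n)"
    then show "?j \<sigma> \<in> carrier (reduced_wreath r n)"
      by (intro wreath_proj_mem[OF r]) (simp_all add: sym_group_def)
  next
    fix \<sigma> \<tau> assume "\<sigma> \<in> carrier (sym_group n)" "\<tau> \<in> carrier (sym_group n)"
    then show "?j (\<sigma> \<otimes>\<^bsub>sym_group n\<^esub> \<tau>) = ?j \<sigma> \<otimes>\<^bsub>reduced_wreath r n\<^esub> ?j \<tau>"
      using wreath_proj_mult_sym[OF r P.one_closed] by (simp add: sym_group_def)
  qed
  then have "subgroup (?j ` carrier (sym_group n)) (reduced_wreath r n)"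
    by (rule group_hom.img_is_subgroup)
  moreover have "?j ` carrier (sym_group n) = sym_subgroup r n"
    by (auto simp: sym_subgroup_eq[OF r] sym_group_def)
  ultimately show ?thesis by simp
qed

lemma finite_reduced_wreath:
  assumes r: "r \<ge> 1"
  shows "finite (carrier (reduced_wreath r n))"
proof -
  have "carrier (wreath r n) = carrier (Gam_pow r n) \<times> {\<sigma>. \<sigma> permutes {1..n}}"
    by (auto simp: wreath_carrier)
  then have "finite (carrier (wreath r n))"
    by (simp add: finite_Gam_pow finite_permutations)
  then show ?thesis using wreath_proj_identification(1)[OF r, of n] by (metis finite_imageI)
qed

text \<open>Since (g, sigma) = (g, id)(1, sigma), right invariance under S_n says that a function
  ignores the permutation; a function of the coset of g remains.\<close>

lemma rspace_induced_sym:
  assumes r: "r \<ge> 1"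
  shows "F \<in> rspace (induced_rep (reduced_wreath r n) (sym_subgroup r n) trivial_rep) \<longleftrightarrow>
    (\<forall>y. y \<notin> carrier (reduced_wreath r n) \<longrightarrow> F y = 0) \<and>
    (\<forall>g\<in>carrier (Gam_pow r n). \<forall>\<sigma>. \<sigma> permutes {1..n} \<longrightarrow>
       F (wreath_proj r n (g, \<sigma>)) = F (wreath_proj r n (g, id)))" (is "?L \<longleftrightarrow> ?Z \<and> ?R")
proof -
  have "(\<forall>y\<in>carrier (reduced_wreath r n). \<forall>s\<in>sym_subgroup r n. F (y \<otimes>\<^bsub>reduced_wreath r n\<^esub> s) = F y) \<longleftrightarrow> ?R"
    (is "?I \<longleftrightarrow> _")
  proof
    assume inv: ?I
    show ?R
    proof (intro ballI allI impI)
      fix g \<sigma> assume g: "g \<in> carrier (Gam_pow r n)" and \<sigma>: "\<sigma> permutes {1..n}"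
      have "wreath_proj r n (\<one>\<^bsub>Gam_pow r n\<^esub>, \<sigma>) \<in> sym_subgroup r n"
        using \<sigma> by (auto simp: sym_subgroup_eq[OF r])
      then show "F (wreath_proj r n (g, \<sigma>)) = F (wreath_proj r n (g, id))"
        using inv wreath_proj_mem[OF r g permutes_id] wreath_proj_mult_sym[OF r g permutes_id \<sigma>] by fastforce
    qed
  next
    assume R: ?R
    show ?I
    proof (intro ballI)
      fix y s assume y: "y \<in> carrier (reduced_wreath r n)" and s: "s \<in> sym_subgroup r n"
      obtain g \<sigma> where g: "g \<in> carrier (Gam_pow r n)" "\<sigma> permutes {1..n}" "y = wreath_proj r n (g, \<sigma>)"
        using reduced_wreath_cases[OF r y] .
      obtain \<tau> where \<tau>: "\<tau> permutes {1..n}" "s = wreath_proj r n (\<one>\<^bsub>Gam_pow r n\<^esub>, \<tau>)"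
        using s by (auto simp: sym_subgroup_eq[OF r])
      have "F (wreath_proj r n (g, \<sigma> \<circ> \<tau>)) = F (wreath_proj r n (g, \<sigma>))"
        using R g(1,2) permutes_compose[OF \<tau>(1) g(2)] by metis
      then show "F (y \<otimes>\<^bsub>reduced_wreath r n\<^esub> s) = F y"
        by (simp only: g(3) \<tau>(2) wreath_proj_mult_sym[OF r g(1,2) \<tau>(1)])
    qed
  qed
  then show ?thesis by (auto simp: induced_rep_def trivial_rep_def)
qed

lemma kernel_wreath_proj:
  "r \<ge> 1 \<Longrightarrow> kernel (wreath r n) (reduced_wreath r n) (wreath_proj r n) = diag_subgroup r n"
  by (rule wreath_proj_identification(2))

lemma
  assumes r: "r \<ge> 1" and k: "k \<in> compositions r n" and dvd: "r dvd (\<Sum>i<r. i * k ! i)"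
  shows ract_CM_reduced: "\<And>x f. x \<in> carrier (wreath r n) \<Longrightarrow> f \<in> rspace (CM n k) \<Longrightarrow>
      ract (CM_reduced r n k) (wreath_proj r n x) f = ract (CM n k) x f"
    and irreducible_CM_reduced: "irreducible_rep (reduced_wreath r n) (CM_reduced r n k)"
proof -
  have kn: "sum_list k = n" using k by (simp add: compositions_def)
  have triv: "acts_trivially (kernel (wreath r n) (reduced_wreath r n) (wreath_proj r n)) (CM n k)"
    using acts_trivially_diag_CM[OF r k] dvd by (simp add: kernel_wreath_proj[OF r])
  note hom = wreath_proj_hom[OF r, of n] and surj = wreath_proj_identification(1)[OF r, of n]
  show "\<And>x f. x \<in> carrier (wreath r n) \<Longrightarrow> f \<in> rspace (CM n k) \<Longrightarrow>
      ract (CM_reduced r n k) (wreath_proj r n x) f = ract (CM n k) x f"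
    unfolding CM_reduced_def by (rule ract_descend[OF hom is_rep_CM[OF r kn] triv])
  show "irreducible_rep (reduced_wreath r n) (CM_reduced r n k)"
    unfolding CM_reduced_def by (rule irreducible_rep_descend[OF hom surj irreducible_rep_CM[OF r k] triv])
qed

lemma CM_reduced_sel [simp]:
  "rscale (CM_reduced r n k) = cscale" "rspace (CM_reduced r n k) = rspace (CM n k)"
  by (simp_all add: CM_reduced_def)

lemma rep_degree_CM_reduced:
  assumes "k \<in> compositions r n"
  shows "real (rep_degree (CM_reduced r n k)) = fact n / (\<Prod>i<r. fact (k ! i))"
proof -
  have k: "sum_list k = n" "length k = r" using assms by (auto simp: compositions_def)
  have "rep_degree (CM_reduced r n k) = card (exponents n k)"
    by (simp add: rep_degree_def CM_def Mon_eq[OF k(1)] dim_span_monomials)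
  moreover have "real (card (exponents n k) * (\<Prod>i<r. fact (k ! i))) = real (fact n)"
    using card_exponents[OF k(1)] k(2) by (simp only:)
  moreover have "(\<Prod>i<r. fact (k ! i) :: real) \<noteq> 0" by simp
  ultimately show ?thesis by (simp add: field_simps)
qed

lemma rep_iso_CM_reduced_imp_eq:
  assumes r: "r \<ge> 1" and k: "k \<in> compositions r n" "r dvd (\<Sum>i<r. i * k ! i)"
    and k': "k' \<in> compositions r n" "r dvd (\<Sum>i<r. i * k' ! i)"
    and iso: "rep_iso (reduced_wreath r n) (CM_reduced r n k) (CM_reduced r n k')"
  shows "k = k'"
proof -
  have triv: "acts_trivially (kernel (wreath r n) (reduced_wreath r n) (wreath_proj r n)) (CM n l)"
    if "l \<in> compositions r n" "r dvd (\<Sum>i<r. i * l ! i)" for l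
    using acts_trivially_diag_CM[OF r that(1)] that(2) by (simp add: kernel_wreath_proj[OF r])
  have rep: "is_rep (wreath r n) (CM n l)" if "l \<in> compositions r n" for l
    using that by (intro is_rep_CM[OF r]) (simp add: compositions_def)
  show ?thesis
    using rep_iso_CM_imp_eq[OF r k(1) k'(1)] rep_iso_descend[OF wreath_proj_hom[OF r] rep rep triv triv]
      iso k k' unfolding CM_reduced_def by blast
qed

lemma rep_iso_direct_sum_induced:
  fixes r n :: nat
  assumes r: "r \<ge> 1"
  defines "I \<equiv> {k \<in> compositions r n. r dvd (\<Sum>i<r. i * k ! i)}"
  shows "rep_iso (reduced_wreath r n) (rep_direct_sum I (CM_reduced r n))
    (induced_rep (reduced_wreath r n) (sym_subgroup r n) trivial_rep)"
proof -
  let ?H = "reduced_wreath r n" and ?P = "carrier (Gam_pow r n)" and ?\<pi> = "wreath_proj r n"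
  let ?D = "rep_direct_sum I (CM_reduced r n)" and ?N = "induced_rep ?H (sym_subgroup r n) trivial_rep"
  interpret h: group_hom "wreath r n" ?H ?\<pi> by (rule wreath_proj_hom[OF r])
  have I: "finite I" unfolding I_def using finite_compositions by simp
  have kI: "k \<in> compositions r n" "r dvd (\<Sum>i<r. i * k ! i)" "sum_list k = n" "length k = r" if "k \<in> I" for k
    using that by (auto simp: I_def compositions_def)
  have irr: "irreducible_rep ?H (CM_reduced r n k)" if "k \<in> I" for k
    using irreducible_CM_reduced[OF r] kI[OF that] by blast
  have rep: "is_rep ?H ?D"
    by (rule is_rep_direct_sum[OF I h.H.group_axioms])
      (use irr in \<open>auto simp: vector_space_cscale irreducible_rep_def\<close>)
  have sp: "f \<in> rspace ?D \<longleftrightarrow> (\<forall>k\<in>I. f k \<in> rspace (CM n k)) \<and> (\<forall>k. k \<notin> I \<longrightarrow> f k = 0)" for f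
    by (simp add: rspace_rep_direct_sum[OF I])
  have lookup_eq_0: "Poly_Mapping.lookup (f k) m = 0" if "f \<in> rspace ?D" "k \<in> I" "m \<notin> exponents n k" for f k m
  proof -
    have "f k \<in> rspace (CM n k)" using that(1,2) by (simp add: sp)
    then show ?thesis using that(3) by (simp add: rspace_CM[OF kI(3)[OF that(2)]] keys_subset_iff)
  qed
  \<comment> \<open>Evaluation at an arbitrary representative of the coset \<open>fst y\<close>.
    Ignoring \<open>snd y\<close> gives S_n-invariance, and the value 0 off the carrier is the
    convention of \<open>induced_rep\<close>.\<close>
  define T :: "(nat list \<Rightarrow> cpoly) \<Rightarrow> (nat \<Rightarrow> complex) set \<times> (nat \<Rightarrow> nat) \<Rightarrow> complex"
    where "T f y = (if y \<in> carrier ?H then \<Sum>k\<in>I. poly_eval n (f k) (SOME g. g \<in> fst y) else 0)" for f y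
  have T: "T f (?\<pi> (g, \<sigma>)) = (\<Sum>k\<in>I. poly_eval n (f k) g)"
    if f: "f \<in> rspace ?D" and g: "g \<in> ?P" and \<sigma>: "\<sigma> permutes {1..n}" for f g \<sigma>
  proof -
    obtain d where d: "d \<in> Gam_diag r n" "(SOME h. h \<in> fst (?\<pi> (g, \<sigma>))) = d \<otimes>\<^bsub>Gam_pow r n\<^esub> g"
      using Gam_diag_coset_some[OF r g] .
    have "poly_eval n (f k) (d \<otimes>\<^bsub>Gam_pow r n\<^esub> g) = poly_eval n (f k) g" if "k \<in> I" for k
      using f that by (intro poly_eval_diag[OF r kI(1,2)[OF that] _ d(1)]) (simp add: sp)
    then show ?thesis using wreath_proj_mem[OF r g \<sigma>] by (simp add: T_def d(2))
  qed
  show ?thesis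
  proof (rule rep_iso_transport[OF rep])
    show "vector_space (rscale ?N)"
      by standard (auto simp: induced_rep_def trivial_rep_def fun_eq_iff algebra_simps)
    show "linear_map_on (rscale ?D) (rscale ?N) (rspace ?D) T"
      by (auto simp: linear_map_on_def T_def fun_eq_iff poly_eval_add poly_eval_cscale sum.distrib
          sum_distrib_left induced_rep_def trivial_rep_def)
    show "T (ract ?D x f) = ract ?N x (T f)" if x: "x \<in> carrier ?H" and f: "f \<in> rspace ?D" for x f
    proof
      fix y
      show "T (ract ?D x f) y = ract ?N x (T f) y"
      proof (cases "y \<in> carrier ?H")
        case True
        obtain h \<tau> where h: "h \<in> ?P" "\<tau> permutes {1..n}" "x = ?\<pi> (h, \<tau>)"
          using reduced_wreath_cases[OF r x] .
        obtain g \<sigma> where g: "g \<in> ?P" "\<sigma> permutes {1..n}" "y = ?\<pi> (g, \<sigma>)"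
          using reduced_wreath_cases[OF r True] .
        have hc: "(h, \<tau>) \<in> carrier (wreath r n)" and gc: "(g, \<sigma>) \<in> carrier (wreath r n)"
          using h g by (simp_all add: wreath_carrier)
        \<comment> \<open>A lift to the wreath product of the point x^-1 y at which the induced
          action evaluates; then g = h tau(g'), the shape that \<open>poly_eval_ract_CM\<close>
          needs.\<close>
        obtain g' \<sigma>' where g': "inv\<^bsub>wreath r n\<^esub> (h, \<tau>) \<otimes>\<^bsub>wreath r n\<^esub> (g, \<sigma>) = (g', \<sigma>')"
          by (cases "inv\<^bsub>wreath r n\<^esub> (h, \<tau>) \<otimes>\<^bsub>wreath r n\<^esub> (g, \<sigma>)")
        then have g'c: "(g', \<sigma>') \<in> carrier (wreath r n)" using hc gc by (metis h.G.inv_closed h.G.m_closed)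
        have "(h, \<tau>) \<otimes>\<^bsub>wreath r n\<^esub> (g', \<sigma>') = (g, \<sigma>)"
          using hc gc by (simp add: g'[symmetric] h.G.m_assoc[symmetric])
        then have g_eq: "g = h \<otimes>\<^bsub>Gam_pow r n\<^esub> perm_act n \<tau> g'" by (simp add: wreath_mult)
        have "?\<pi> (g', \<sigma>') = inv\<^bsub>?H\<^esub> x \<otimes>\<^bsub>?H\<^esub> y"
          using hc gc by (simp add: g'[symmetric] h(3) g(3))
        then have "ract ?N x (T f) y = T f (?\<pi> (g', \<sigma>'))"
          using True by (simp add: induced_rep_def)
        also have "\<dots> = (\<Sum>k\<in>I. poly_eval n (f k) g')"
          using g'c by (intro T[OF f]) (simp_all add: wreath_carrier)
        also have "\<dots> = (\<Sum>k\<in>I. poly_eval n (ract ?D x f k) g)"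
        proof (rule sum.cong[OF refl])
          fix k assume k: "k \<in> I"
          then have fk: "f k \<in> rspace (CM n k)" using f by (simp add: sp)
          have "ract ?D x f k = ract (CM n k) (h, \<tau>) (f k)"
            using k ract_CM_reduced[OF r kI(1,2)[OF k] hc fk] by (simp add: h(3))
          then show "poly_eval n (f k) g' = poly_eval n (ract ?D x f k) g"
            using poly_eval_ract_CM[OF r kI(3)[OF k] fk h(1,2)] by (simp add: g_eq)
        qed
        also have "\<dots> = T (ract ?D x f) y"
          unfolding g(3) by (rule T[OF is_repD(7)[OF rep x f] g(1,2), symmetric])
        finally show ?thesis by simp
      qed (simp add: T_def induced_rep_def)
    qed
    show "bij_betw T (rspace ?D) (rspace ?N)"
      unfolding bij_betw_def
    proof
      have coeff: "fourier_coeff r n (\<lambda>g. T f (?\<pi> (g, id))) m = Poly_Mapping.lookup (f k) m"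
        if f: "f \<in> rspace ?D" and k: "k \<in> I" and m: "m \<in> exponents n k" for f k m
      proof -
        \<comment> \<open>Distinct modules have disjoint sets of exponents, so adding the components
          into one polynomial loses nothing, and Fourier coefficients recover each of them.\<close>
        let ?q = "\<Sum>k\<in>I. f k"
        note keys = lookup_eq_0[OF f]
        have "poly_eval n (\<Sum>k\<in>J. f k) g = (\<Sum>k\<in>J. poly_eval n (f k) g)" for J g
          by (induction J rule: infinite_finite_induct) (simp_all add: poly_eval_add, simp_all add: poly_eval_def)
        then have "fourier_coeff r n (\<lambda>g. T f (?\<pi> (g, id))) m = fourier_coeff r n (poly_eval n ?q) m"
          unfolding fourier_coeff_def by (simp add: T[OF f _ permutes_id] cong: sum.cong)
        also have "\<dots> = Poly_Mapping.lookup ?q m"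
        proof (rule fourier_coeff_poly_eval[OF r])
          show "Poly_Mapping.keys ?q \<subseteq> exponent_box r n"
            unfolding keys_subset_iff exponent_box_eq lookup_sum
            using keys kI(1) by (auto intro!: sum.neutral)
          show "m \<in> exponent_box r n" using m kI(1)[OF k] by (auto simp: exponent_box_eq)
        qed
        also have "\<dots> = (\<Sum>l\<in>I. if l = k then Poly_Mapping.lookup (f k) m else 0)"
          unfolding lookup_sum
        proof (rule sum.cong[OF refl])
          fix l assume l: "l \<in> I"
          have "m \<notin> exponents n l" if "l \<noteq> k"
            using exponents_unique[OF m] kI(4)[OF l] kI(4)[OF k] that by metis
          then show "Poly_Mapping.lookup (f l) m = (if l = k then Poly_Mapping.lookup (f k) m else 0)"
            using keys[OF l] by simp
        qed
        also have "\<dots> = Poly_Mapping.lookup (f k) m" using k I by simp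
        finally show ?thesis .
      qed
      show "inj_on T (rspace ?D)"
      proof (rule inj_onI)
        fix f f' assume f: "f \<in> rspace ?D" "f' \<in> rspace ?D" "T f = T f'"
        show "f = f'"
        proof
          fix k show "f k = f' k"
          proof (cases "k \<in> I")
            case True
            have "Poly_Mapping.lookup (f k) m = Poly_Mapping.lookup (f' k) m" for m
            proof (cases "m \<in> exponents n k")
              case m: True
              show ?thesis using coeff[OF f(1) True m] coeff[OF f(2) True m] f(3) by simp
            next
              case False
              then show ?thesis using lookup_eq_0[OF f(1) True] lookup_eq_0[OF f(2) True] by simp
            qed
            then show ?thesis by (rule poly_mapping_eqI)
          qed (use f in \<open>simp add: sp\<close>)
        qed
      qed
      show "T ` rspace ?D = rspace ?N"
      proof (rule Set.set_eqI, rule iffI)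
        fix F assume "F \<in> T ` rspace ?D"
        then obtain f where "f \<in> rspace ?D" "F = T f" by blast
        then show "F \<in> rspace ?N"
          unfolding rspace_induced_sym[OF r] using T permutes_id by (auto simp: T_def)
      next
        fix F assume "F \<in> rspace ?N"
        then have F0: "\<And>y. y \<notin> carrier ?H \<Longrightarrow> F y = 0"
          and F1: "\<And>g \<sigma>. g \<in> ?P \<Longrightarrow> \<sigma> permutes {1..n} \<Longrightarrow> F (?\<pi> (g, \<sigma>)) = F (?\<pi> (g, id))"
          unfolding rspace_induced_sym[OF r] by blast+
        define \<phi> where "\<phi> g = F (?\<pi> (g, id))" for g
        \<comment> \<open>The preimage of F: the Fourier coefficients of \<open>\<phi>\<close>,
          distributed over the modules according to their exponents.\<close>
        define f where "f k = (if k \<in> I then \<Sum>m\<in>exponents n k. Poly_Mapping.single m (fourier_coeff r n \<phi> m) else 0)" for k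
        have lookup_f: "Poly_Mapping.lookup (f k) m = (if m \<in> exponents n k then fourier_coeff r n \<phi> m else 0)"
          if "k \<in> I" for k m
          using that by (simp add: f_def lookup_sum lookup_single when_def finite_exponents)
        have keys_f: "Poly_Mapping.keys (f k) \<subseteq> exponents n k" if "k \<in> I" for k
          by (simp add: keys_subset_iff lookup_f[OF that])
        then have f: "f \<in> rspace ?D" by (auto simp: sp rspace_CM kI(3)) (simp add: f_def)
        have "T f (?\<pi> (g, \<sigma>)) = F (?\<pi> (g, \<sigma>))" if g: "g \<in> ?P" and \<sigma>: "\<sigma> permutes {1..n}" for g \<sigma>
        proof -
          \<comment> \<open>\<open>\<phi>\<close> is invariant under the diagonal, so the sum over I
            may be extended to all compositions, hence to the whole box.\<close>
          have zero: "fourier_coeff r n \<phi> m = 0" if "k \<in> compositions r n" "k \<notin> I" "m \<in> exponents n k" for k m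
            using that by (intro fourier_coeff_diag_invariant[OF r that(1,3)])
              (simp_all add: \<phi>_def wreath_proj_diag[OF r] I_def)
          have disj: "\<forall>k\<in>compositions r n. \<forall>l\<in>compositions r n. k \<noteq> l \<longrightarrow> exponents n k \<inter> exponents n l = {}"
            by (auto simp: compositions_def dest: exponents_unique)
          have "T f (?\<pi> (g, \<sigma>)) = (\<Sum>k\<in>I. \<Sum>m\<in>exponents n k. fourier_coeff r n \<phi> m * monom_eval n m g)"
            unfolding T[OF f g \<sigma>]
            by (rule sum.cong[OF refl]) (simp add: poly_eval_superset[OF finite_exponents keys_f] lookup_f)
          also have "\<dots> = (\<Sum>k\<in>compositions r n. \<Sum>m\<in>exponents n k. fourier_coeff r n \<phi> m * monom_eval n m g)"
            using kI(1) by (intro sum.mono_neutral_left finite_compositions) (auto simp: zero)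
          also have "\<dots> = (\<Sum>m\<in>exponent_box r n. fourier_coeff r n \<phi> m * monom_eval n m g)"
            unfolding exponent_box_eq
            by (rule sum.UNION_disjoint[symmetric]) (simp_all add: finite_compositions finite_exponents disj)
          also have "\<dots> = F (?\<pi> (g, \<sigma>))"
            using F1[OF g \<sigma>] by (simp add: fourier_inversion[OF r g] \<phi>_def)
          finally show ?thesis .
        qed
        then have "T f y = F y" for y
          by (cases "y \<in> carrier ?H") (auto elim!: reduced_wreath_cases[OF r] simp: F0, simp add: T_def)
        then show "F \<in> T ` rspace ?D" using f by (metis ext imageI)
      qed
    qed
  qed
qed

theorem theorem2p6:
  fixes r n :: nat
  assumes "r \<ge> 1" and "n \<ge> 1"
  shows
    "(\<forall>k\<in>compositions r n.
        is_rep (wreath r n) (CM n k) \<and>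
        (descends_to (wreath r n) (reduced_wreath r n) (wreath_proj r n) (CM n k)
           \<longleftrightarrow> r dvd (\<Sum>i<r. i * k ! i)) \<and>
        (acts_trivially (diag_subgroup r n) (CM n k) \<longleftrightarrow> r dvd (\<Sum>i<r. i * k ! i)) \<and>
        (r dvd (\<Sum>i<r. i * k ! i) \<longrightarrow>
           (\<forall>x\<in>carrier (wreath r n). \<forall>f\<in>rspace (CM n k).
              ract (CM_reduced r n k) (wreath_proj r n x) f = ract (CM n k) x f) \<and>
           irreducible_rep (reduced_wreath r n) (CM_reduced r n k) \<and>
           real (rep_degree (CM_reduced r n k)) = fact n / (\<Prod>i<r. fact (k ! i)))) \<and>
     gelfand_pair (reduced_wreath r n) (sym_subgroup r n) \<and>
     decomposes_into_irreducibles (reduced_wreath r n)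
       (induced_rep (reduced_wreath r n) (sym_subgroup r n) trivial_rep)
       {k \<in> compositions r n. r dvd (\<Sum>i<r. i * k ! i)}
       (CM_reduced r n)"
proof -
  note r = assms(1)
  let ?H = "reduced_wreath r n" and ?K = "sym_subgroup r n"
  let ?I = "{k \<in> compositions r n. r dvd (\<Sum>i<r. i * k ! i)}"
  have irr: "irreducible_rep ?H (CM_reduced r n k)" if "k \<in> ?I" for k
    using that irreducible_CM_reduced[OF r] by blast
  have fin: "finite ?I" using finite_compositions by simp
  have ind: "rep_iso ?H (induced_rep ?H ?K trivial_rep) (rep_direct_sum ?I (CM_reduced r n))"
    by (rule rep_iso_sym[OF rep_iso_direct_sum_induced[OF r]])
  have perm: "rep_iso ?H (permutation_rep ?H ?K) (rep_direct_sum ?I (CM_reduced r n))"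
    by (rule rep_iso_trans[OF rep_iso_permutation_induced[OF group_reduced_wreath[OF r] subgroup_sym_subgroup[OF r]] ind])
  \<comment> \<open>\<open>gelfand_pair\<close> speaks of functions on cosets; they are isomorphic
    to the induced representation, hence to the same sum of pairwise non-isomorphic modules.\<close>
  have "multiplicity_free ?H (permutation_rep ?H ?K)"
  proof (rule multiplicity_free_direct_sum)
    show "decomposes_into_irreducibles ?H (permutation_rep ?H ?K) ?I (CM_reduced r n)"
      unfolding decomposes_into_irreducibles_def using fin irr perm by blast
  qed (use rep_iso_CM_reduced_imp_eq[OF r] in blast)
  then have gelfand: "gelfand_pair ?H ?K"
    by (simp add: gelfand_pair_def group_reduced_wreath[OF r] finite_reduced_wreath[OF r] subgroup_sym_subgroup[OF r])
  have dec: "decomposes_into_irreducibles ?H (induced_rep ?H ?K trivial_rep) ?I (CM_reduced r n)"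
    unfolding decomposes_into_irreducibles_def using fin irr ind by blast
  have rep: "is_rep (wreath r n) (CM n k)" if "k \<in> compositions r n" for k
    using that by (intro is_rep_CM[OF r]) (simp add: compositions_def)
  have desc: "descends_to (wreath r n) ?H (wreath_proj r n) (CM n k) \<longleftrightarrow> r dvd (\<Sum>i<r. i * k ! i)"
    if "k \<in> compositions r n" for k
    using descends_to_iff[OF wreath_proj_hom[OF r] wreath_proj_identification(1)[OF r] rep[OF that]]
      acts_trivially_diag_CM[OF r that] by (simp add: kernel_wreath_proj[OF r])
  show ?thesis
    using rep desc acts_trivially_diag_CM[OF r] ract_CM_reduced[OF r] irreducible_CM_reduced[OF r]
      rep_degree_CM_reduced gelfand dec by (intro conjI ballI impI) simp_all
qed

end
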